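(* Let $r\ge 1$ and $k\ge 1$. The number of sequences $(\tau_1,\dots,\tau_r)$ of star transpositions such that $\pi=\tau_1\tau_2\cdots\tau_r$ has exactly $k$ cycles is \[ \sum_{\substack{\mu\vdash n\\ j\in\mu}}\frac{d_\mu\,d_{j_-(\mu)}\,c_{\mu,j}^{\,r}}{n!}\,e_{n-k}(\mathbf{c}_\mu) = [t^k]\sum_{\substack{\mu\vdash n\\ j\in\mu}}\frac{d_\mu\,d_{j_-(\mu)}\,c_{\mu,j}^{\,r}}{n!}\,c_\mu(t), \] where the sums are over all $\mu\vdash n$ and distinct parts $j$ of $\mu$.
   Context: $\mathfrak{S}_n$ is the symmetric group on $\{1,\dots,n\}$ (products read right to left; cycles counted including fixed points). A star transposition is a transposition $(j,n)$ with $1\le j\le n-1$. $d_\nu$ is the number of standard Young tableaux of shape $\nu$; $j_-(\mu)\vdash n-1$ is obtained from $\mu$ by replacing one part $j$ by $j-1$ (deleting it if $j=1$). $c_{\mu,j}:=j-\sum_{i\ge j}m_i(\mu)$, where $m_i(\mu)$ is the multiplicity of $i$ as a part of $\mu$. The content of the cell in row $a$, column $b$ of a Young diagram is $b-a$; $\mathbf{c}_\mu$ is the multiset of the $n$ contents of the cells of the diagram of $\mu$; $e_{m}$ is the $m$-th elementary symmetric polynomial; $c_\mu(t)=\prod_{c\in\mathbf{c}_\mu}(t+c)$ is the content polynomial. *)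

theory Defs
  imports
    "HOL-Library.Multiset"
    "HOL-Library.FuncSet"
    "HOL-Combinatorics.Transposition"
    "HOL-Combinatorics.Orbits"
    "HOL-Computational_Algebra.Polynomial"
begin

section \<open>Products of star transpositions\<close>

definition star_transpositions :: "nat \<Rightarrow> (nat \<Rightarrow> nat) set" where
  "star_transpositions n = {transpose j n | j. 1 \<le> j \<and> j \<le> n - 1}"

text \<open>Products are read from right to left.\<close>

definition perm_product :: "('a \<Rightarrow> 'a) list \<Rightarrow> 'a \<Rightarrow> 'a" where
  "perm_product \<tau>s = foldr (\<circ>) \<tau>s id"

text \<open>Fixed points in \<open>{1..n}\<close> are singleton orbits, hence counted as cycles.\<close>

definition num_cycles :: "nat \<Rightarrow> (nat \<Rightarrow> nat) \<Rightarrow> nat" where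
  "num_cycles n p = card (orbit p ` {1..n})"

section \<open>Partitions, Young diagrams and standard Young tableaux\<close>

text \<open>A partition is represented by the multiset of its (positive) parts.\<close>

definition partitions :: "nat \<Rightarrow> nat multiset set" where
  "partitions n = {\<mu>. 0 \<notin># \<mu> \<and> \<Sum>\<^sub># \<mu> = n}"

definition part_dec :: "nat \<Rightarrow> nat multiset \<Rightarrow> nat multiset" where
  "part_dec j \<mu> = \<mu> - {#j#} + (if j = 1 then {#} else {#j - 1#})"

text \<open>The sum of the multiplicities \<open>m\<^sub>i(\<mu>)\<close> over all \<open>i \<ge> j\<close> has finite support,
  since \<open>m\<^sub>i(\<mu>) = 0\<close> unless \<open>i\<close> is a part of \<open>\<mu>\<close>.\<close>

definition part_content :: "nat multiset \<Rightarrow> nat \<Rightarrow> int" where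
  "part_content \<mu> j = int j - int (\<Sum>i | i \<in># \<mu> \<and> i \<ge> j. count \<mu> i)"

definition rows :: "nat multiset \<Rightarrow> nat list" where
  "rows \<mu> = rev (sorted_list_of_multiset \<mu>)"

text \<open>Rows and columns are numbered from 1.\<close>

definition cells :: "nat multiset \<Rightarrow> (nat \<times> nat) set" where
  "cells \<mu> = {(a, b). 1 \<le> a \<and> a \<le> length (rows \<mu>) \<and> 1 \<le> b \<and> b \<le> rows \<mu> ! (a - 1)}"

definition standard_tableaux :: "nat multiset \<Rightarrow> (nat \<times> nat \<Rightarrow> nat) set" where
  "standard_tableaux \<nu> = {T \<in> extensional (cells \<nu>).
     bij_betw T (cells \<nu>) {1..\<Sum>\<^sub># \<nu>} \<and>
     (\<forall>a b. (a, b) \<in> cells \<nu> \<and> (a, b + 1) \<in> cells \<nu> \<longrightarrow> T (a, b) < T (a, b + 1)) \<and>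
     (\<forall>a b. (a, b) \<in> cells \<nu> \<and> (a + 1, b) \<in> cells \<nu> \<longrightarrow> T (a, b) < T (a + 1, b))}"

definition num_syt :: "nat multiset \<Rightarrow> nat" where
  "num_syt \<nu> = card (standard_tableaux \<nu>)"

section \<open>Contents\<close>

definition contents :: "nat multiset \<Rightarrow> int multiset" where
  "contents \<mu> = image_mset (\<lambda>(a, b). int b - int a) (mset_set (cells \<mu>))"

text \<open>The elementary symmetric polynomial of degree \<open>m\<close>, evaluated at the elements
  \<open>x\<^sub>0, x\<^sub>1, \<dots>\<close> of a multiset listed with multiplicity. The degree is an integer, so that it
  is 0 in negative degree.\<close>

definition elem_sym :: "int \<Rightarrow> int multiset \<Rightarrow> int" where
  "elem_sym m M = (let xs = sorted_list_of_multiset M in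
     \<Sum>S | S \<subseteq> {..<length xs} \<and> int (card S) = m. \<Prod>i\<in>S. xs ! i)"

definition content_poly :: "nat multiset \<Rightarrow> rat poly" where
  "content_poly \<mu> = (\<Prod>c\<in>#contents \<mu>. [:of_int c, 1:])"

end

theory Submission
  imports Defs "HOL-Library.Poly_Mapping" "HOL-Combinatorics.Permutations"
begin

text \<open>
  Let \<open>J\<^sub>i\<close> be the sum of the transpositions \<open>(j, i)\<close> with \<open>j < i\<close> (a Jucys--Murphy element) in the group
  algebra of the symmetric group. By Jucys, \<open>(t + J\<^sub>1) \<cdots> (t + J\<^sub>n)\<close> is the sum of all permutations \<open>\<pi>\<close>
  weighted by \<open>t\<close> to the number of cycles of \<open>\<pi>\<close>. Hence the generating polynomial in \<open>t\<close> of
  the sequences of star transpositions is the coefficient of the identity in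
  \<open>J\<^sub>n\<^sup>r (t + J\<^sub>1) \<cdots> (t + J\<^sub>n)\<close>.

  The coefficient of the identity in a polynomial \<open>f(J\<^sub>1, \<dots>, J\<^sub>n)\<close> is the expectation of \<open>f\<close> at
  the content vector of a random standard tableau \<open>T\<close> of size \<open>n\<close>, chosen with probability
  \<open>d\<^sub>\<mu> / n!\<close> where \<open>\<mu>\<close> is the shape of \<open>T\<close>. This is proved by induction on \<open>n\<close> without representation
  theory: the projection of \<open>J\<^sub>n\<^sub>+\<^sub>1\<^sup>m\<close> to the group algebra of the symmetric group on \<open>n\<close> points
  satisfies a recursion coming from \<open>s J\<^sub>n\<^sub>+\<^sub>1 = J\<^sub>n s + 1\<close> with \<open>s = (n, n+1)\<close>, and the moments of
  the transition probabilities of the Plancherel growth process satisfy the same recursion.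
  That the growth process has the marginals \<open>d\<^sub>\<mu> / n!\<close> for single tableaux is Frobenius' formula,
  which is proved by partial fractions.
\<close>

section \<open>The group algebra of the finitary symmetric group\<close>

text \<open>Composition is written additively, so that the convolution product of
  \<^theory>\<open>HOL-Library.Poly_Mapping\<close> is the product of the group algebra.\<close>

typedef fperm = "{p :: nat \<Rightarrow> nat. permutation p}"
  morphisms app Abs_fperm
  using permutation_id by blast

setup_lifting type_definition_fperm

instantiation fperm :: group_add
begin

lift_definition zero_fperm :: fperm is id by (rule permutation_id)
lift_definition plus_fperm :: "fperm \<Rightarrow> fperm \<Rightarrow> fperm" is "(\<circ>)" by (rule permutation_compose)
lift_definition uminus_fperm :: "fperm \<Rightarrow> fperm" is inv by (rule permutation_inverse)
definition minus_fperm :: "fperm \<Rightarrow> fperm \<Rightarrow> fperm" where "minus_fperm p q = p + (- q)"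
instance
  by standard
    (transfer; simp add: comp_assoc permutation_inverse_works minus_fperm_def | simp add: minus_fperm_def)+
end

lemma app_zero [simp]: "app 0 = id" by transfer simp

lemma app_plus [simp]: "app (p + q) = app p \<circ> app q" by transfer simp

lemma app_uminus: "app (- p) = inv (app p)" by transfer simp

lemma permutation_app: "permutation (app p)" using app by auto

lemma bij_app: "bij (app p)" by (simp add: permutation_app permutation_bijective)

lemma app_eq_iff [simp]: "app p x = app p y \<longleftrightarrow> x = y"
  using bij_app[of p] by (simp add: bij_def inj_eq)

lemma fperm_eqI: "(\<And>x. app p x = app q x) \<Longrightarrow> p = q"
  by transfer auto

lift_definition tr :: "nat \<Rightarrow> nat \<Rightarrow> fperm" is transpose
  by (simp add: permutation_swap_id)

declare tr.rep_eq [simp]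

text \<open>All symmetric groups sit inside one ambient group, so the step from \<open>n\<close> to
  \<open>n + 1\<close> is an inclusion and needs no embedding map.\<close>

definition symgrp :: "nat \<Rightarrow> fperm set" where
  "symgrp n = {p. app p permutes {1..n}}"

lemma symgrp_iff: "p \<in> symgrp n \<longleftrightarrow> (\<forall>x. x \<notin> {1..n} \<longrightarrow> app p x = x)"
  unfolding symgrp_def permutes_def mem_Collect_eq using bij_app[of p] by (metis bij_pointE)

lemma symgrp_0: "symgrp 0 = {0}"
  by (auto simp: symgrp_iff intro!: fperm_eqI)

lemma symgrp_mono: "m \<le> n \<Longrightarrow> symgrp m \<subseteq> symgrp n"
  by (auto simp: symgrp_iff)

lemma symgrp_zero [simp]: "0 \<in> symgrp n" by (simp add: symgrp_iff)

lemma symgrp_plus: "p \<in> symgrp n \<Longrightarrow> q \<in> symgrp n \<Longrightarrow> p + q \<in> symgrp n"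
  by (auto simp: symgrp_iff)

lemma symgrp_uminus: "p \<in> symgrp n \<Longrightarrow> - p \<in> symgrp n"
  by (simp add: symgrp_def app_uminus permutes_inv)

lemma symgrp_plus_left_iff: "p \<in> symgrp n \<Longrightarrow> p + q \<in> symgrp n \<longleftrightarrow> q \<in> symgrp n"
  using symgrp_plus[of p n q] symgrp_plus[OF symgrp_uminus, of p n "p + q"] by (auto simp: add.assoc[symmetric])

lemma symgrp_plus_right_iff: "q \<in> symgrp n \<Longrightarrow> p + q \<in> symgrp n \<longleftrightarrow> p \<in> symgrp n"
  using symgrp_plus[of p n q] symgrp_plus[OF _ symgrp_uminus, of "p + q" n q] by (auto simp: add.assoc)

lemma tr_in_symgrp: "i \<in> {1..n} \<Longrightarrow> j \<in> {1..n} \<Longrightarrow> tr i j \<in> symgrp n"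
  by (auto simp: symgrp_iff transpose_def)

lemma tr_notin_symgrp: "i \<noteq> Suc n \<Longrightarrow> tr i (Suc n) \<notin> symgrp n"
  by (auto simp: symgrp_iff transpose_def intro!: exI[of _ "Suc n"])

section \<open>The group algebra and its projection to fewer points\<close>

type_synonym galg = "fperm \<Rightarrow>\<^sub>0 rat"

lemma poly_mapping_sum_singles:
  "X = (\<Sum>p\<in>Poly_Mapping.keys X. Poly_Mapping.single p (Poly_Mapping.lookup X p))"
  by (rule poly_mapping_eqI)
    (auto simp: lookup_sum lookup_single when_def not_in_keys_iff_lookup_eq_zero sum.delta')

lemma galg_induct [consumes 1, case_names zero single add]:
  fixes X :: galg
  assumes "Poly_Mapping.keys X \<subseteq> S"
    and "P 0" "\<And>p c. p \<in> S \<Longrightarrow> P (Poly_Mapping.single p c)"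
    and "\<And>Y Z. P Y \<Longrightarrow> P Z \<Longrightarrow> P (Y + Z)"
  shows "P X"
proof -
  have "P (\<Sum>p\<in>B. Poly_Mapping.single p (Poly_Mapping.lookup X p))" if "finite B" "B \<subseteq> S" for B
    using that by (induction B) (auto intro: assms)
  then show ?thesis using assms(1) poly_mapping_sum_singles[of X] by (metis finite_keys)
qed

text \<open>This is the conditional expectation onto the group algebra of the symmetric group on
  \<open>n\<close> points.\<close>

definition proj :: "nat \<Rightarrow> galg \<Rightarrow> galg" where
  "proj n = Poly_Mapping.mapp (\<lambda>p c. if p \<in> symgrp n then c else 0)"

lemma lookup_proj: "Poly_Mapping.lookup (proj n X) p = (if p \<in> symgrp n then Poly_Mapping.lookup X p else 0)"
  by (auto simp: proj_def lookup_mapp when_def in_keys_iff)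

lemma proj_zero [simp]: "proj n 0 = 0"
  by (rule poly_mapping_eqI) (simp add: lookup_proj)

lemma proj_add: "proj n (X + Y) = proj n X + proj n Y"
  by (rule poly_mapping_eqI) (simp add: lookup_proj lookup_add)

lemma proj_diff: "proj n (X - Y) = proj n X - proj n Y"
  by (rule poly_mapping_eqI) (simp add: lookup_proj lookup_minus)

lemma proj_single: "proj n (Poly_Mapping.single p c) = (if p \<in> symgrp n then Poly_Mapping.single p c else 0)"
  by (rule poly_mapping_eqI) (auto simp: lookup_proj lookup_single when_def)

lemma proj_one [simp]: "proj n 1 = 1"
  using proj_single[of n 0 1] by simp

lemma proj_sum: "proj n (sum f A) = (\<Sum>x\<in>A. proj n (f x))"
  by (induction A rule: infinite_finite_induct) (auto simp: proj_add)

definition subalg :: "nat \<Rightarrow> galg set" where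
  "subalg n = {X. Poly_Mapping.keys X \<subseteq> symgrp n}"

lemma subalg_mono: "m \<le> n \<Longrightarrow> X \<in> subalg m \<Longrightarrow> X \<in> subalg n"
  using symgrp_mono by (auto simp: subalg_def)

lemma subalg_add: "X \<in> subalg n \<Longrightarrow> Y \<in> subalg n \<Longrightarrow> X + Y \<in> subalg n"
  using keys_add[of X Y] by (auto simp: subalg_def)

lemma subalg_single: "p \<in> symgrp n \<Longrightarrow> Poly_Mapping.single p c \<in> subalg n"
  by (auto simp: subalg_def)

lemma subalg_one: "1 \<in> subalg n"
  by (auto simp: subalg_def)

lemma subalg_mult: "X \<in> subalg n \<Longrightarrow> Y \<in> subalg n \<Longrightarrow> X * Y \<in> subalg n"
  using keys_mult[of X Y] symgrp_plus by (fastforce simp: subalg_def)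

lemma subalg_zero: "0 \<in> subalg n"
  by (auto simp: subalg_def)

lemma subalg_sum: "(\<And>x. x \<in> A \<Longrightarrow> f x \<in> subalg n) \<Longrightarrow> sum f A \<in> subalg n"
  by (induction A rule: infinite_finite_induct) (auto intro: subalg_add subalg_zero)

lemma subalg_power: "X \<in> subalg n \<Longrightarrow> X ^ m \<in> subalg n"
  by (induction m) (auto intro: subalg_mult subalg_one)

text \<open>Translation by an element of \<open>symgrp n\<close> preserves both
  \<open>symgrp n\<close> and its complement; \<open>proj_mult_right\<close> is the mirror
  image.\<close>

lemma proj_mult_left: "X \<in> subalg n \<Longrightarrow> proj n (X * Y) = X * proj n Y"
proof -
  have single: "proj n (Poly_Mapping.single p c * Y) = Poly_Mapping.single p c * proj n Y"
    if "p \<in> symgrp n" for p c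
  proof (induction Y rule: galg_induct[OF subset_UNIV])
    case (2 q d)
    then show ?case using symgrp_plus_left_iff[OF that, of q]
      by (auto simp: mult_single proj_single)
  qed (auto simp: proj_add algebra_simps)
  assume "X \<in> subalg n"
  then have "Poly_Mapping.keys X \<subseteq> symgrp n" by (simp add: subalg_def)
  then show ?thesis
    by (induction X rule: galg_induct) (auto simp: single proj_add algebra_simps)
qed

lemma proj_mult_right: "Y \<in> subalg n \<Longrightarrow> proj n (X * Y) = proj n X * Y"
proof -
  have single: "proj n (X * Poly_Mapping.single p c) = proj n X * Poly_Mapping.single p c"
    if "p \<in> symgrp n" for p c
  proof (induction X rule: galg_induct[OF subset_UNIV])
    case (2 q d)
    then show ?case using symgrp_plus_right_iff[OF that, of q]
      by (auto simp: mult_single proj_single)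
  qed (auto simp: proj_add algebra_simps)
  assume "Y \<in> subalg n"
  then have "Poly_Mapping.keys Y \<subseteq> symgrp n" by (simp add: subalg_def)
  then show ?thesis
    by (induction Y rule: galg_induct) (auto simp: single proj_add algebra_simps)
qed

definition \<delta> :: "fperm \<Rightarrow> galg" where "\<delta> p = Poly_Mapping.single p 1"

lemma \<delta>_mult: "\<delta> p * \<delta> q = \<delta> (p + q)"
  by (simp add: \<delta>_def mult_single)

lemma \<delta>_zero: "\<delta> 0 = 1" by (simp add: \<delta>_def)

lemma tr_tr [simp]: "tr i j + tr i j = 0"
  by (rule fperm_eqI) (simp add: transpose_def)

lemma \<delta>_tr_square: "\<delta> (tr i j) * \<delta> (tr i j) = 1"
  by (simp add: \<delta>_mult \<delta>_zero)

section \<open>Jucys--Murphy elements\<close>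

definition JM :: "nat \<Rightarrow> galg" where
  "JM n = (\<Sum>j\<in>{1..<n}. \<delta> (tr j n))"

lemma JM_1: "JM (Suc 0) = 0" by (simp add: JM_def)

lemma JM_in_subalg: "JM n \<in> subalg n"
  unfolding JM_def by (auto intro!: subalg_sum subalg_single tr_in_symgrp simp: \<delta>_def)

lemma proj_JM: "proj n (JM (Suc n)) = 0"
  unfolding JM_def proj_sum by (rule sum.neutral) (auto simp: \<delta>_def proj_single tr_notin_symgrp)

text \<open>Conjugation by a permutation of \<open>{1..n}\<close> fixes \<open>n + 1\<close> and
  hence only permutes the transpositions \<open>(j, n + 1)\<close>.\<close>

lemma JM_commutes: "X \<in> subalg n \<Longrightarrow> X * JM (Suc n) = JM (Suc n) * X"
proof -
  have single: "Poly_Mapping.single p c * JM (Suc n) = JM (Suc n) * Poly_Mapping.single p c"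
    if p: "p \<in> symgrp n" for p c
  proof -
    have perm: "app p permutes {1..n}" using p by (simp add: symgrp_def)
    have conj: "p + tr j (Suc n) = tr (app p j) (Suc n) + p" if "j \<in> {1..n}" for j
    proof (rule fperm_eqI)
      have "app p (Suc n) = Suc n" using p by (simp add: symgrp_iff)
      moreover from this have "app p x = Suc n \<longleftrightarrow> x = Suc n" for x by (metis app_eq_iff)
      ultimately show "app (p + tr j (Suc n)) x = app (tr (app p j) (Suc n) + p) x" for x
        by (auto simp: transpose_def)
    qed
    have "Poly_Mapping.single p c * JM (Suc n) = (\<Sum>j\<in>{1..n}. Poly_Mapping.single (p + tr j (Suc n)) c)"
      by (simp add: JM_def sum_distrib_left \<delta>_def mult_single atLeastLessThanSuc_atLeastAtMost)
    also have "\<dots> = (\<Sum>j\<in>{1..n}. Poly_Mapping.single (tr (app p j) (Suc n) + p) c)"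
      by (rule sum.cong) (simp_all only: conj)
    also have "\<dots> = (\<Sum>j\<in>{1..n}. Poly_Mapping.single (tr j (Suc n) + p) c)"
      by (rule sum.reindex_bij_betw[OF permutes_imp_bij[OF perm], of "\<lambda>j. Poly_Mapping.single (tr j (Suc n) + p) c"])
    also have "\<dots> = JM (Suc n) * Poly_Mapping.single p c"
      by (simp add: JM_def sum_distrib_right \<delta>_def mult_single atLeastLessThanSuc_atLeastAtMost)
    finally show ?thesis .
  qed
  assume "X \<in> subalg n"
  then have "Poly_Mapping.keys X \<subseteq> symgrp n" by (simp add: subalg_def)
  then show ?thesis by (induction X rule: galg_induct) (auto simp: single algebra_simps)
qed

text \<open>Moving \<open>s = (n, n + 1)\<close> past \<open>(j, n + 1)\<close> turns the latter
  into \<open>(j, n)\<close> for \<open>j < n\<close>; the remaining summand \<open>j = n\<close> is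
  \<open>s\<close> itself and contributes \<open>s * s = 1\<close>.\<close>

lemma coxeter_JM:
  assumes "n \<ge> 1"
  shows "\<delta> (tr n (Suc n)) * JM (Suc n) = JM n * \<delta> (tr n (Suc n)) + 1"
proof -
  have "tr n (Suc n) + tr j (Suc n) = tr j n + tr n (Suc n)" if "j \<in> {1..<n}" for j
    using that by (intro fperm_eqI) (auto simp: transpose_def)
  then have "(\<Sum>j\<in>{1..<n}. \<delta> (tr n (Suc n) + tr j (Suc n))) = (\<Sum>j\<in>{1..<n}. \<delta> (tr j n + tr n (Suc n)))"
    by (intro sum.cong) simp_all
  moreover have "{1..<Suc n} = insert n {1..<n}" using assms by auto
  ultimately show ?thesis
    by (simp add: JM_def sum_distrib_left sum_distrib_right \<delta>_mult \<delta>_zero algebra_simps)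
qed

text \<open>For \<open>p\<close> on \<open>n + 1\<close> points, the conjugate of \<open>p\<close>
  by \<open>(n + 1, n + 2)\<close> fixes \<open>n + 2\<close> exactly if \<open>p\<close> fixes
  \<open>n + 1\<close>; then the supports are disjoint and the conjugate is \<open>p\<close>
  itself.\<close>

lemma proj_coxeter_conj:
  assumes X: "X \<in> subalg (Suc n)"
  defines "s \<equiv> \<delta> (tr (Suc n) (Suc (Suc n)))"
  shows "proj (Suc n) (s * X * s) = proj n X"
proof -
  have single: "proj (Suc n) (s * Poly_Mapping.single p c * s) = proj n (Poly_Mapping.single p c)"
    if p: "p \<in> symgrp (Suc n)" for p c
  proof -
    define q where "q = tr (Suc n) (Suc (Suc n)) + p + tr (Suc n) (Suc (Suc n))"
    have fix2: "app p (Suc (Suc n)) = Suc (Suc n)" using p by (simp add: symgrp_iff)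
    have eq: "s * Poly_Mapping.single p c * s = Poly_Mapping.single q c"
      by (simp add: s_def \<delta>_def mult_single q_def)
    show ?thesis
    proof (cases "app p (Suc n) = Suc n")
      case True
      have *: "app p x = Suc n \<longleftrightarrow> x = Suc n" "app p x = Suc (Suc n) \<longleftrightarrow> x = Suc (Suc n)" for x
        using True fix2 by (metis app_eq_iff)+
      have "q = p" by (rule fperm_eqI) (auto simp: q_def transpose_def True fix2 *)
      moreover have "p \<in> symgrp n" unfolding symgrp_iff
      proof (intro allI impI)
        fix x assume "x \<notin> {1..n}"
        then have "x = Suc n \<or> x \<notin> {1..Suc n}" by auto
        then show "app p x = x" using True p by (auto simp: symgrp_iff)
      qed
      ultimately show ?thesis unfolding eq using p by (simp add: proj_single)
    next
      case False
      have "app p (Suc n) \<noteq> Suc (Suc n)" using fix2 by (metis app_eq_iff n_not_Suc_n)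
      then have "app q (Suc (Suc n)) = app p (Suc n)" using False by (simp add: q_def transpose_def)
      then have "q \<notin> symgrp (Suc n)" using \<open>app p (Suc n) \<noteq> Suc (Suc n)\<close>
        by (auto simp: symgrp_iff intro!: exI[of _ "Suc (Suc n)"])
      moreover have "p \<notin> symgrp n" using False by (auto simp: symgrp_iff intro!: exI[of _ "Suc n"])
      ultimately show ?thesis unfolding eq by (simp add: proj_single)
    qed
  qed
  have "Poly_Mapping.keys X \<subseteq> symgrp (Suc n)" using X by (simp add: subalg_def)
  then show ?thesis by (induction X rule: galg_induct) (auto simp: single distrib_left distrib_right proj_add)
qed

definition JM_moment :: "nat \<Rightarrow> nat \<Rightarrow> galg" where
  "JM_moment n m = proj n (JM (Suc n) ^ m)"

lemma JM_moment_0 [simp]: "JM_moment n 0 = 1"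
  by (simp add: JM_moment_def)

lemma JM_moment_1 [simp]: "JM_moment n (Suc 0) = 0"
  by (simp add: JM_moment_def proj_JM)

text \<open>With \<open>Z m = M m - M' m\<close> this reads
  \<open>Z (m+2) = 2 Z (m+1) a - Z m a^2 + M m\<close>; it comes from eliminating
  \<open>y m = E (s b^m)\<close> from two first-order recursions. The doubled term is written as a
  sum, and \<open>a\<close> always stands on the right, so that the closure rules of
  \<open>represents\<close> apply literally.\<close>

lemma JM_moment_rec:
  fixes n m :: nat
  defines "a \<equiv> JM (Suc n)"
    and "M \<equiv> JM_moment (Suc n)" and "M' \<equiv> JM_moment n"
  shows "M (Suc (Suc m)) = M' (Suc (Suc m)) + (M (Suc m) - M' (Suc m)) * a + (M (Suc m) - M' (Suc m)) * a
           - (M m - M' m) * a * a + M m"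
proof -
  define b where "b = JM (Suc (Suc n))"
  define s where "s = \<delta> (tr (Suc n) (Suc (Suc n)))"
  define E where "E = proj (Suc n)"
  define y where "y k = E (s * b ^ k)" for k
  define Z where "Z m = M m - M' m" for m
  have a_sub: "a \<in> subalg (Suc n)" by (simp add: a_def JM_in_subalg)
  have sb: "s * b = a * s + 1" unfolding s_def b_def a_def by (rule coxeter_JM) simp
  have as: "a * s = s * b - 1" using sb by simp
  have ss: "s * s = 1" by (simp add: s_def \<delta>_tr_square)
  have ab: "a * b = b * a" using JM_commutes[OF a_sub] by (simp add: b_def)
  have ab_pow: "a ^ i * b ^ j = b ^ j * a ^ i" for i j
    using ab by (metis power_commuting_commutes)
  have M: "M m = E (b ^ m)" for m by (simp add: M_def E_def b_def JM_moment_def)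
  \<comment> \<open>Conjugation by \<open>s\<close> writes a projection to \<open>n\<close> points
    as one to \<open>n + 1\<close> points, so \<open>M\<close> and \<open>M'\<close> become values
    of the same map \<open>E\<close>.\<close>
  have M': "M' m = E (s * a ^ m * s)" for m
    unfolding M'_def E_def s_def JM_moment_def
    using proj_coxeter_conj[OF subalg_power[OF a_sub, of m]] by (simp add: a_def)
  have y0: "y 0 = 0"
    by (auto simp: y_def E_def s_def \<delta>_def proj_single tr_notin_symgrp)
  have ySuc: "y (Suc k) = a * y k + M k" for k
  proof -
    have "s * b ^ Suc k = a * (s * b ^ k) + b ^ k"
      using sb by (simp add: mult.assoc[symmetric]) (simp add: algebra_simps)
    then show ?thesis
      by (simp add: y_def M E_def proj_add proj_mult_left[OF a_sub])
  qed
  have aM: "M k * a = a * M k" for k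
    using ab_pow[of 1 k] by (simp add: M E_def proj_mult_left[OF a_sub, symmetric] proj_mult_right[OF a_sub, symmetric])
  have ay: "y k * a = a * y k" for k
  proof (induction k)
    case (Suc k)
    then show ?case by (simp add: ySuc aM distrib_left distrib_right mult.assoc)
  qed (simp add: y0)
  \<comment> \<open>The factors of \<open>a ^ m\<close> are pushed rightwards through
    \<open>s\<close> one at a time. By \<open>as\<close>, each turns into a factor \<open>b\<close>
    and leaves a term with \<open>y\<close> behind; \<open>k\<close> is general because the power of
    \<open>b\<close> grows.\<close>
  have conj: "E (b ^ (m + k)) - E (s * a ^ m * s * b ^ k) = (\<Sum>i<m. y (k + i) * a ^ (m - Suc i))" for m k
  proof (induction m arbitrary: k)
    case 0
    then show ?case by (simp add: ss)
  next
    case (Suc m)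
    have "s * a ^ Suc m * s * b ^ k = s * a ^ m * (a * s) * b ^ k"
      by (simp only: power_Suc2 mult.assoc)
    also have "\<dots> = s * a ^ m * s * b ^ Suc k - s * b ^ k * a ^ m"
      unfolding as using ab_pow[of m k] by (simp add: algebra_simps)
    finally have "E (s * a ^ Suc m * s * b ^ k) = E (s * a ^ m * s * b ^ Suc k) - y k * a ^ m"
      by (simp add: E_def proj_diff y_def proj_mult_right[OF subalg_power[OF a_sub]])
    then show ?case using Suc[of "Suc k"]
      by (simp add: sum.lessThan_Suc_shift del: sum.lessThan_Suc power_Suc)
  qed
  have Z: "Z m = (\<Sum>i<m. y i * a ^ (m - Suc i))" for m
    using conj[of m 0] by (simp add: Z_def M M')
  have ZSuc: "Z (Suc m) = Z m * a + y m" for m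
    unfolding Z by (auto simp: sum_distrib_right Suc_diff_Suc power_Suc2[symmetric] mult.assoc
        simp del: power_Suc intro!: sum.cong)
  have "Z (Suc (Suc m)) = Z (Suc m) * a + (a * y m + M m)"
    by (simp only: ZSuc[of "Suc m"] ySuc)
  also have "a * y m = (Z (Suc m) - Z m * a) * a"
    by (simp add: ZSuc ay)
  finally show ?thesis by (simp add: Z_def algebra_simps)
qed

section \<open>Transition probabilities of the Plancherel growth process\<close>

text \<open>As a function of \<open>y\<close> the product tends to 1 at infinity and has simple
  poles at the \<open>x i\<close>, with residue \<open>e\<close> times the product over the other
  indices. The induction hypothesis is used at \<open>y\<close> and also at \<open>y = x u\<close>,
  which evaluates the residue at the new pole.\<close>

lemma prod_partial_fractions:
  fixes x :: "'a \<Rightarrow> 'b :: field" and e :: 'b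
  assumes "finite A" "inj_on x A" "y \<notin> x ` A"
  shows "(\<Prod>j\<in>A. 1 + e / (y - x j))
    = 1 + e * (\<Sum>i\<in>A. (\<Prod>j\<in>A-{i}. 1 + e / (x i - x j)) / (y - x i))"
  using assms
proof (induction A arbitrary: y rule: finite_induct)
  case (insert u A)
  define P where "P i = (\<Prod>j\<in>A-{i}. 1 + e / (x i - x j))" for i
  have IH: "(\<Prod>j\<in>A. 1 + e / (z - x j)) = 1 + e * (\<Sum>i\<in>A. P i / (z - x i))" if "z \<notin> x ` A" for z
    using insert.IH[of z] insert.prems that by (simp add: P_def)
  have yu: "y - x u \<noteq> 0" using insert.prems by auto
  have *: "(\<Prod>j\<in>insert u A - {i}. 1 + e / (x i - x j)) / (y - x i)
      = P i / (y - x i) + e * (P i / (y - x i) / (y - x u)) - e * (P i / (x u - x i) / (y - x u))"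
    if i: "i \<in> A" for i
  proof -
    have ui: "x u - x i \<noteq> 0" "y - x i \<noteq> 0" using insert i by (auto simp: inj_on_def)
    have "insert u A - {i} = insert u (A - {i})" using insert i by auto
    then have eq: "(\<Prod>j\<in>insert u A - {i}. 1 + e / (x i - x j)) = (1 + e / (x i - x u)) * P i"
      using insert by (simp add: P_def)
    have "x i - x u \<noteq> 0" using ui by auto
    then show ?thesis unfolding eq using ui yu
      by (simp add: divide_simps) (simp add: algebra_simps)
  qed
  have "insert u A - {u} = A" using insert by auto
  moreover have "x u \<notin> x ` A" using insert by auto
  ultimately have u: "(\<Prod>j\<in>insert u A - {u}. 1 + e / (x u - x j)) = 1 + e * (\<Sum>i\<in>A. P i / (x u - x i))"
    using IH[of "x u"] by simp
  have "(\<Prod>j\<in>insert u A. 1 + e / (y - x j)) = (1 + e / (y - x u)) * (1 + e * (\<Sum>i\<in>A. P i / (y - x i)))"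
    using insert IH[of y] by simp
  also have "\<dots> = 1 + e * ((1 + e * (\<Sum>i\<in>A. P i / (x u - x i))) / (y - x u)
      + ((\<Sum>i\<in>A. P i / (y - x i)) + e * ((\<Sum>i\<in>A. P i / (y - x i)) / (y - x u)) - e * ((\<Sum>i\<in>A. P i / (x u - x i)) / (y - x u))))"
    using yu by (simp add: divide_simps) (simp add: algebra_simps)
  also have "\<dots> = 1 + e * (\<Sum>i\<in>insert u A. (\<Prod>j\<in>insert u A - {i}. 1 + e / (x i - x j)) / (y - x i))"
    unfolding sum.insert[OF insert.hyps] u
    by (simp add: * sum.distrib sum_subtractf sum_distrib_left sum_divide_distrib)
  finally show ?case .
qed simp

text \<open>These identities compare the coefficients of \<open>1/y\<close> and \<open>1/y^2\<close>
  at infinity in \<open>prod_partial_fractions\<close>. The case \<open>e = 1\<close> serves for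
  adding boxes, \<open>e = -1\<close> for removing them.\<close>

lemma sum_interpolation_weights:
  fixes x :: "'a \<Rightarrow> 'b :: field" and e :: 'b
  assumes "finite A" "inj_on x A"
  defines "P \<equiv> \<lambda>A i. \<Prod>j\<in>A-{i}. 1 + e / (x i - x j)"
  shows "(\<Sum>i\<in>A. P A i) = of_nat (card A)"
    and "(\<Sum>i\<in>A. x i * P A i) = (\<Sum>i\<in>A. x i) + e * of_nat (card A choose 2)"
proof -
  have "(\<Sum>i\<in>A. P A i) = of_nat (card A) \<and>
      (\<Sum>i\<in>A. x i * P A i) = (\<Sum>i\<in>A. x i) + e * of_nat (card A choose 2)"
    using assms(1,2)
  proof (induction A rule: finite_induct)
    case (insert u A)
    have ne: "x u - x i \<noteq> 0" "x i - x u \<noteq> 0" if "i \<in> A" for i using insert that by (auto simp: inj_on_def)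
    have *: "P (insert u A) i = P A i - e * (P A i / (x u - x i))" if i: "i \<in> A" for i
    proof -
      have "insert u A - {i} = insert u (A - {i})" using insert i by auto
      then have "P (insert u A) i = (1 + e / (x i - x u)) * P A i"
        using insert by (simp add: P_def)
      then show ?thesis using ne[OF i] by (simp add: divide_simps) (simp add: algebra_simps)
    qed
    have **: "x i * P (insert u A) i = x i * P A i + e * P A i - x u * (e * (P A i / (x u - x i)))" if i: "i \<in> A" for i
      unfolding *[OF i] using ne[OF i] by (simp add: divide_simps) (simp add: algebra_simps)
    have "insert u A - {u} = A" using insert by auto
    then have u: "P (insert u A) u = 1 + e * (\<Sum>i\<in>A. P A i / (x u - x i))"
      using prod_partial_fractions[of A x "x u" e] insert by (auto simp: P_def)
    define S where "S = (\<Sum>i\<in>A. P A i / (x u - x i))"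
    have "(\<Sum>i\<in>A. P (insert u A) i) = (\<Sum>i\<in>A. P A i) - e * S"
      by (simp add: * S_def sum_subtractf sum_distrib_left)
    moreover have "(\<Sum>i\<in>A. x i * P (insert u A) i) = (\<Sum>i\<in>A. x i * P A i) + e * (\<Sum>i\<in>A. P A i) - x u * (e * S)"
      by (simp add: ** S_def sum.distrib sum_subtractf sum_distrib_left)
    moreover have "inj_on x A" using insert by simp
    ultimately show ?case using insert u[folded S_def]
      by (simp add: numeral_2_eq_2) (simp add: algebra_simps)
  qed (simp add: P_def numeral_2_eq_2)
  then show "(\<Sum>i\<in>A. P A i) = of_nat (card A)"
    "(\<Sum>i\<in>A. x i * P A i) = (\<Sum>i\<in>A. x i) + e * of_nat (card A choose 2)" by auto
qed

text \<open>From here on a partition is an antitone function \<open>\<nu>\<close> giving the row lengths; rows are numbered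
  from 0.\<close>

definition addable :: "(nat \<Rightarrow> nat) \<Rightarrow> nat \<Rightarrow> bool" where
  "addable \<nu> i \<longleftrightarrow> i = 0 \<or> \<nu> i < \<nu> (i - 1)"

abbreviation add_box :: "(nat \<Rightarrow> nat) \<Rightarrow> nat \<Rightarrow> nat \<Rightarrow> nat" where
  "add_box \<nu> i \<equiv> \<nu>(i := Suc (\<nu> i))"

text \<open>This is the content of the cell that would be added to row \<open>i\<close>.\<close>

definition row_content :: "(nat \<Rightarrow> nat) \<Rightarrow> nat \<Rightarrow> rat" where
  "row_content \<nu> i = of_nat (\<nu> i) - of_nat i"

text \<open>The probability \<open>d\<^sub>\<kappa> / ((n + 1) d\<^sub>\<nu>)\<close> of adding a box to row \<open>i\<close> of \<open>\<nu>\<close>, where \<open>\<nu>\<close> has size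
  \<open>n\<close> and \<open>\<kappa>\<close> is the result, read off Frobenius' formula. The number \<open>L\<close> of rows taken into account
  does not matter as long as it exceeds the number of non-empty rows.\<close>

definition trans_weight :: "nat \<Rightarrow> (nat \<Rightarrow> nat) \<Rightarrow> nat \<Rightarrow> rat" where
  "trans_weight L \<nu> i =
     (\<Prod>j\<in>{..<L} - {i}. 1 + 1 / (row_content \<nu> i - row_content \<nu> j)) / (row_content \<nu> i + of_nat L)"

section \<open>Mass, mean and moments of the transition weights\<close>

lemma row_content_less: "antimono \<nu> \<Longrightarrow> i < j \<Longrightarrow> row_content \<nu> j < row_content \<nu> i"
proof -
  assume "antimono \<nu>" "i < j"
  then have "\<nu> j \<le> \<nu> i" by (simp add: antimonoD)
  then have "(of_nat (\<nu> j) :: rat) \<le> of_nat (\<nu> i)" "(of_nat i :: rat) < of_nat j"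
    using \<open>i < j\<close> by simp_all
  then show ?thesis unfolding row_content_def by linarith
qed

lemma row_content_eq_iff: "antimono \<nu> \<Longrightarrow> row_content \<nu> i = row_content \<nu> j \<longleftrightarrow> i = j"
  by (metis row_content_less less_irrefl linorder_neqE_nat)

lemma inj_row_content: "antimono \<nu> \<Longrightarrow> inj_on (row_content \<nu>) A"
  by (simp add: inj_on_def row_content_eq_iff)

lemma row_content_gt: "i < L \<Longrightarrow> row_content \<nu> i + of_nat L > 0"
  unfolding row_content_def by (metis add_diff_eq add_increasing diff_add_eq diff_gt_0_iff_gt
      add.commute add_pos_nonneg of_nat_0_le_iff of_nat_less_iff)

text \<open>Partial fractions are evaluated at \<open>y = -L\<close>, where the factor of the empty
  row \<open>L - 1\<close>, of content \<open>1 - L\<close>, vanishes; this gives total mass 1. The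
  mean follows because weight times content is \<open>P i\<close> minus \<open>L\<close> times the
  weight, and the \<open>P i\<close> add up to \<open>L\<close>.\<close>

lemma sum_trans_weight:
  assumes "antimono \<nu>" "\<nu> (L - 1) = 0" "L > 0"
  shows "(\<Sum>i<L. trans_weight L \<nu> i) = 1"
    and "(\<Sum>i<L. trans_weight L \<nu> i * row_content \<nu> i) = 0"
proof -
  define P where "P i = (\<Prod>j\<in>{..<L} - {i}. 1 + 1 / (row_content \<nu> i - row_content \<nu> j))" for i
  have W: "trans_weight L \<nu> i = P i / (row_content \<nu> i + of_nat L)" for i
    by (simp add: P_def trans_weight_def)
  have pos: "row_content \<nu> i + of_nat L > 0" if "i < L" for i using row_content_gt[OF that] .
  have "- of_nat L \<notin> row_content \<nu> ` {..<L}"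
    using pos by force
  then have "(\<Prod>j<L. 1 + 1 / (- of_nat L - row_content \<nu> j)) = 1 + 1 * (\<Sum>i<L. P i / (- of_nat L - row_content \<nu> i))"
    unfolding P_def using assms(1) by (intro prod_partial_fractions) (auto simp: inj_row_content)
  moreover have "(\<Prod>j<L. 1 + 1 / (- of_nat L - row_content \<nu> j)) = 0"
    using assms by (auto simp: prod_zero_iff row_content_def of_nat_diff intro!: bexI[of _ "L - 1"])
  moreover have "(\<Sum>i<L. P i / (- of_nat L - row_content \<nu> i)) = - (\<Sum>i<L. trans_weight L \<nu> i)"
    unfolding sum_negf[symmetric] W by (intro sum.cong) (simp_all add: minus_divide_right del: divide_minus_right)
  ultimately show 1: "(\<Sum>i<L. trans_weight L \<nu> i) = 1" by simp
  have "(\<Sum>i<L. P i) = of_nat L"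
    using sum_interpolation_weights(1)[OF _ inj_row_content[OF assms(1)], of "{..<L}" 1] by (simp add: P_def)
  moreover have "(\<Sum>i<L. trans_weight L \<nu> i * row_content \<nu> i) = (\<Sum>i<L. P i - of_nat L * trans_weight L \<nu> i)"
    using pos by (intro sum.cong) (auto simp: W divide_simps algebra_simps dest!: pos)
  ultimately show "(\<Sum>i<L. trans_weight L \<nu> i * row_content \<nu> i) = 0"
    by (simp add: sum_subtractf sum_distrib_left[symmetric] 1)
qed

text \<open>The factor of row \<open>i - 1\<close> is \<open>1 + 1 / (-1)\<close>. Sums over addable
  rows may therefore be extended to all rows below \<open>L\<close>.\<close>

lemma trans_weight_not_addable:
  assumes "antimono \<nu>" "i < L" "\<not> addable \<nu> i"
  shows "trans_weight L \<nu> i = 0"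
proof -
  have "i > 0" "\<nu> i = \<nu> (i - 1)"
    using assms antimonoD[OF assms(1), of "i - 1" i] by (auto simp: addable_def)
  then have "row_content \<nu> i - row_content \<nu> (i - 1) = -1" "i - 1 \<in> {..<L} - {i}"
    using assms(2) by (auto simp: row_content_def of_nat_diff)
  then show ?thesis unfolding trans_weight_def by (auto intro!: bexI[of _ "i - 1"] simp: prod_zero_iff)
qed

lemma antimono_add_box: "antimono \<nu> \<Longrightarrow> addable \<nu> k \<Longrightarrow> antimono (add_box \<nu> k)"
proof -
  assume a: "antimono \<nu>" "addable \<nu> k"
  show ?thesis
  proof (rule antimonoI)
    fix x y :: nat assume "x \<le> y"
    have "\<nu> k < \<nu> x" if "x < k"
      using a(2) that antimonoD[OF a(1), of x "k - 1"] unfolding addable_def by linarith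
    then show "add_box \<nu> k y \<le> add_box \<nu> k x"
      using antimonoD[OF a(1) \<open>x \<le> y\<close>] \<open>x \<le> y\<close> by (cases "x = k"; cases "y = k") fastforce+
  qed
qed

lemma row_content_add_box:
  "row_content (add_box \<nu> k) k = row_content \<nu> k + 1"
  "i \<noteq> k \<Longrightarrow> row_content (add_box \<nu> k) i = row_content \<nu> i"
  by (auto simp: row_content_def)

text \<open>Only the factor \<open>j = k\<close> changes, from \<open>1 + 1/D\<close> to
  \<open>1 + 1/(D - 1)\<close>. The relation is kept free of division because \<open>D = -1\<close>
  occurs, namely when row \<open>i = k + 1\<close> is as long as row \<open>k\<close> and becomes
  addable through the new box.\<close>

lemma trans_weight_add_box:
  assumes "antimono \<nu>" "addable \<nu> k" "k < L" "i < L" "i \<noteq> k"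
  defines "D \<equiv> row_content \<nu> i - row_content \<nu> k"
  shows "trans_weight L (add_box \<nu> k) i * (D\<^sup>2 - 1) = trans_weight L \<nu> i * D\<^sup>2"
proof -
  define Q where "Q = (\<Prod>j\<in>{..<L} - {i} - {k}. 1 + 1 / (row_content \<nu> i - row_content \<nu> j)) / (row_content \<nu> i + of_nat L)"
  have k: "k \<in> {..<L} - {i}" using assms by auto
  have D: "D \<noteq> 0" using assms by (simp add: D_def row_content_eq_iff)
  have "row_content (add_box \<nu> k) i \<noteq> row_content (add_box \<nu> k) k"
    using assms antimono_add_box by (simp only: row_content_eq_iff) simp
  then have D1: "D - 1 \<noteq> 0" using assms(5) by (simp add: row_content_add_box D_def)
  have 1: "trans_weight L \<nu> i = (1 + 1 / D) * Q"
    unfolding trans_weight_def prod.remove[OF finite_Diff[OF finite_lessThan] k] by (simp add: D_def Q_def)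
  have "(\<Prod>j\<in>{..<L} - {i} - {k}. 1 + 1 / (row_content (add_box \<nu> k) i - row_content (add_box \<nu> k) j))
     = (\<Prod>j\<in>{..<L} - {i} - {k}. 1 + 1 / (row_content \<nu> i - row_content \<nu> j))"
    using assms(5) by (intro prod.cong) (auto simp: row_content_add_box)
  moreover have "row_content (add_box \<nu> k) i - row_content (add_box \<nu> k) k = D - 1"
    using assms(5) by (simp add: row_content_add_box D_def)
  ultimately have 2: "trans_weight L (add_box \<nu> k) i = (1 + 1 / (D - 1)) * Q"
    unfolding trans_weight_def prod.remove[OF finite_Diff[OF finite_lessThan] k]
    using assms(5) by (simp add: Q_def row_content_add_box)
  show ?thesis unfolding 1 2 using D D1 by (simp add: divide_simps) (simp add: algebra_simps power2_eq_square)
qed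

definition trans_moment :: "nat \<Rightarrow> nat \<Rightarrow> (nat \<Rightarrow> nat) \<Rightarrow> rat" where
  "trans_moment L m \<nu> = (\<Sum>i<L. trans_weight L \<nu> i * row_content \<nu> i ^ m)"

text \<open>Summing \<open>trans_weight_add_box\<close> against powers of the contents and expanding
  the squares gives the recursion of \<open>JM_moment_rec\<close>, with the content of the new box
  in place of the Jucys-Murphy element. Row \<open>k\<close> itself contributes zero to both
  sides.\<close>

lemma trans_moment_rec:
  assumes "antimono \<nu>" "addable \<nu> k" "k < L"
  defines "a \<equiv> row_content \<nu> k"
    and "M \<equiv> \<lambda>m. trans_moment L m (add_box \<nu> k)" and "M' \<equiv> \<lambda>m. trans_moment L m \<nu>"
  shows "M (Suc (Suc m)) = M' (Suc (Suc m)) + (M (Suc m) - M' (Suc m)) * a + (M (Suc m) - M' (Suc m)) * a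
           - (M m - M' m) * a * a + M m"
proof -
  define c where "c = row_content (add_box \<nu> k)"
  define c' where "c' = row_content \<nu>"
  have "(\<Sum>i<L. trans_weight L (add_box \<nu> k) i * ((c i - a)\<^sup>2 - 1) * c i ^ m)
      = (\<Sum>i<L. trans_weight L \<nu> i * (c' i - a)\<^sup>2 * c' i ^ m)"
  proof (rule sum.cong)
    fix i assume "i \<in> {..<L}"
    then have "trans_weight L (add_box \<nu> k) i * ((c i - a)\<^sup>2 - 1) = trans_weight L \<nu> i * (c' i - a)\<^sup>2 \<and> (i \<noteq> k \<longrightarrow> c i = c' i)
       \<and> (i = k \<longrightarrow> c i - a = 1 \<and> c' i = a)"
      using trans_weight_add_box[OF assms(1-3), of i]
      by (cases "i = k") (auto simp: c_def c'_def a_def row_content_add_box)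
    then show "trans_weight L (add_box \<nu> k) i * ((c i - a)\<^sup>2 - 1) * c i ^ m = trans_weight L \<nu> i * (c' i - a)\<^sup>2 * c' i ^ m"
      by (cases "i = k") auto
  qed simp
  moreover have "(\<Sum>i<L. trans_weight L (add_box \<nu> k) i * ((c i - a)\<^sup>2 - 1) * c i ^ m)
      = M (Suc (Suc m)) - a * M (Suc m) - a * M (Suc m) + a * a * M m - M m"
    unfolding M_def trans_moment_def c_def[symmetric] sum_distrib_left sum_subtractf[symmetric] sum.distrib[symmetric]
    by (intro sum.cong) (simp_all add: power2_eq_square algebra_simps)
  moreover have "(\<Sum>i<L. trans_weight L \<nu> i * (c' i - a)\<^sup>2 * c' i ^ m)
      = M' (Suc (Suc m)) - a * M' (Suc m) - a * M' (Suc m) + a * a * M' m"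
    unfolding M'_def trans_moment_def c'_def[symmetric] sum_distrib_left sum_subtractf[symmetric] sum.distrib[symmetric]
    by (intro sum.cong) (simp_all add: power2_eq_square algebra_simps)
  ultimately show ?thesis by (simp add: algebra_simps)
qed

section \<open>Paths in Young's lattice\<close>

text \<open>A path is the list of the rows to which boxes are added, the latest one first.\<close>

primrec shape :: "nat list \<Rightarrow> nat \<Rightarrow> nat" where
  "shape [] = (\<lambda>_. 0)"
| "shape (i # T) = add_box (shape T) i"

primrec is_path :: "nat list \<Rightarrow> bool" where
  "is_path [] \<longleftrightarrow> True"
| "is_path (i # T) \<longleftrightarrow> is_path T \<and> addable (shape T) i"

definition paths :: "nat \<Rightarrow> nat list set" where
  "paths n = {T. is_path T \<and> length T = n}"

primrec last_content :: "nat list \<Rightarrow> rat" where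
  "last_content [] = 0"
| "last_content (i # T) = row_content (shape T) i"

text \<open>This is the probability of the path in the Plancherel growth process.\<close>

primrec path_weight :: "nat \<Rightarrow> nat list \<Rightarrow> rat" where
  "path_weight L [] = 1"
| "path_weight L (i # T) = path_weight L T * trans_weight L (shape T) i"

lemma antimono_shape: "is_path T \<Longrightarrow> antimono (shape T)"
  by (induction T) (auto simp: antimono_add_box simp del: fun_upd_apply intro: antimonoI)

lemma addable_le:
  assumes "addable \<nu> i" "\<And>j. j \<ge> n \<Longrightarrow> \<nu> j = 0"
  shows "i \<le> n"
proof (rule ccontr)
  assume "\<not> i \<le> n"
  then have "\<nu> (i - 1) = 0" using assms(2)[of "i - 1"] by auto
  then show False using assms(1) \<open>\<not> i \<le> n\<close> by (auto simp: addable_def)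
qed

lemma shape_eq_0: "is_path T \<Longrightarrow> length T \<le> i \<Longrightarrow> shape T i = 0"
proof (induction T arbitrary: i)
  case (Cons k T)
  then have "k \<le> length T" using addable_le[of "shape T" k "length T"] by auto
  then show ?case using Cons by auto
qed simp

lemma addable_shape_less: "T \<in> paths n \<Longrightarrow> n < L \<Longrightarrow> addable (shape T) i \<Longrightarrow> i < L"
  using addable_le[of "shape T" i n] shape_eq_0[of T] by (auto simp: paths_def)

lemma paths_0: "paths 0 = {[]}"
  by (auto simp: paths_def)

lemma paths_Suc:
  "n < L \<Longrightarrow> paths (Suc n) = (\<lambda>(T, i). i # T) ` (SIGMA T:paths n. {i. i < L \<and> addable (shape T) i})"
  using addable_shape_less[of _ n L] by (fastforce simp: paths_def length_Suc_conv)

lemma finite_paths: "finite (paths n)"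
proof (induction n)
  case (Suc n)
  then show ?case using paths_Suc[of n "Suc n"] by auto
qed (simp add: paths_0)

lemma sum_paths_Suc:
  assumes "n < L"
  shows "(\<Sum>T\<in>paths (Suc n). F T) = (\<Sum>T\<in>paths n. \<Sum>i | i < L \<and> addable (shape T) i. F (i # T))"
proof -
  have "inj_on (\<lambda>(T, i). i # T) (SIGMA T:paths n. {i. i < L \<and> addable (shape T) i})"
    by (auto simp: inj_on_def)
  then show ?thesis unfolding paths_Suc[OF assms]
    by (simp add: sum.reindex sum.Sigma[OF finite_paths] case_prod_unfold)
qed

text \<open>\<open>represents n X f\<close>: the element \<open>X\<close> is a polynomial in \<open>J\<^sub>1, \<dots>, J\<^sub>n\<close>, and \<open>f T\<close> is the value
  of that polynomial at the contents of the boxes along the path \<open>T\<close>.\<close>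

inductive represents :: "nat \<Rightarrow> galg \<Rightarrow> (nat list \<Rightarrow> rat) \<Rightarrow> bool" where
  base: "represents 0 (Poly_Mapping.single 0 c) (\<lambda>_. c)"
| lift: "represents n X f \<Longrightarrow> represents (Suc n) X (\<lambda>T. f (tl T))"
| add: "represents n X f \<Longrightarrow> represents n Y g \<Longrightarrow> represents n (X + Y) (\<lambda>T. f T + g T)"
| JM: "represents (Suc n) X f \<Longrightarrow> represents (Suc n) (X * JM (Suc n)) (\<lambda>T. f T * last_content T)"
| cong: "represents n X f \<Longrightarrow> (\<And>T. T \<in> paths n \<Longrightarrow> f T = g T) \<Longrightarrow> represents n X g"

section \<open>Closure properties of \<open>represents\<close>\<close>

lemma represents_subalg: "represents n X f \<Longrightarrow> X \<in> subalg n"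
proof (induction rule: represents.induct)
  case (lift n X f)
  then show ?case using subalg_mono[of n "Suc n"] by simp
qed (auto intro: subalg_add subalg_mult JM_in_subalg subalg_single)

lemma represents_0: "represents 0 X f \<Longrightarrow> X = Poly_Mapping.single 0 (f [])"
  by (induction "0 :: nat" X f rule: represents.induct) (auto simp: single_add paths_0)

lemma represents_const: "represents n (Poly_Mapping.single 0 c) (\<lambda>_. c)"
  by (induction n) (auto intro: represents.base dest: represents.lift)

lemma represents_one: "represents n 1 (\<lambda>_. 1)"
  using represents_const[of n 1] by simp

text \<open>Elements on \<open>n\<close> points commute with \<open>JM (Suc n)\<close>, so
  \<open>Y\<close> can be moved past every such factor of \<open>X\<close>. Multiplicativity at
  level \<open>n\<close> is a premise because it is the outer induction hypothesis of
  \<open>represents_mult\<close>.\<close>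

lemma represents_mult_lower:
  assumes mult: "\<And>X Y f g. represents n X f \<Longrightarrow> represents n Y g \<Longrightarrow> represents n (X * Y) (\<lambda>T. f T * g T)"
  shows "represents (Suc n) X f \<Longrightarrow> represents n Y g \<Longrightarrow> represents (Suc n) (X * Y) (\<lambda>T. f T * g (tl T))"
proof (induction "Suc n" X f rule: represents.induct)
  case (lift X f)
  then show ?case using represents.lift[OF mult[of X f Y g]] by simp
next
  case (add X f Z h)
  then show ?case using represents.add[of "Suc n" "X * Y" "\<lambda>T. f T * g (tl T)"] by (simp add: distrib_right)
next
  case (JM X f)
  have "X * JM (Suc n) * Y = X * Y * JM (Suc n)"
    using JM_commutes[OF represents_subalg[OF JM.prems]] by (simp add: mult.assoc)
  then show ?case using represents.JM[OF JM.hyps(2)[OF JM.prems]] by (simp add: mult.assoc mult.commute mult.left_commute)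
next
  case (cong X f h)
  then show ?case using represents.cong[of "Suc n" "X * Y" "\<lambda>T. f T * g (tl T)"] by auto
qed

lemma represents_mult:
  "represents n X f \<Longrightarrow> represents n Y g \<Longrightarrow> represents n (X * Y) (\<lambda>T. f T * g T)"
proof (induction n arbitrary: X f Y g)
  case 0
  have "represents 0 (X * Y) (\<lambda>_. f [] * g [])"
    using represents_0[OF 0(1)] represents_0[OF 0(2)] represents.base[of "f [] * g []"] by (simp add: mult_single)
  then show ?case by (rule represents.cong) (simp add: paths_0)
next
  case (Suc n)
  \<comment> \<open>The inner induction is on the derivation for \<open>Y\<close>, since the rule
    \<open>JM\<close> multiplies on the right.\<close>
  from Suc.prems(2,1) show ?case
  proof (induction "Suc n" Y g rule: represents.induct)
    case (lift Y g)
    show ?case by (rule represents_mult_lower[OF _ lift(3) lift(1)]) (rule Suc.IH)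
  next
    case (add Y g Z h)
    then show ?case using represents.add[of "Suc n" "X * Y" "\<lambda>T. f T * g T"] by (simp add: distrib_left)
  next
    case (JM Y g)
    then show ?case using represents.JM[of n "X * Y" "\<lambda>T. f T * g T"] by (simp add: mult.assoc)
  next
    case (cong Y g h)
    then show ?case using represents.cong[of "Suc n" "X * Y" "\<lambda>T. f T * g T"] by auto
  qed
qed

lemma represents_uminus: "represents n X f \<Longrightarrow> represents n (- X) (\<lambda>T. - f T)"
proof -
  assume "represents n X f"
  moreover have "Poly_Mapping.single 0 (-1) * X = - X"
    by (simp add: single_uminus)
  ultimately show ?thesis using represents_mult[OF represents_const[of n "-1"], of X f] by simp
qed

lemma represents_diff:
  "represents n X f \<Longrightarrow> represents n Y g \<Longrightarrow> represents n (X - Y) (\<lambda>T. f T - g T)"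
  using represents.add[OF _ represents_uminus, of n X f Y g] by simp

lemma represents_power: "represents n X f \<Longrightarrow> represents n (X ^ m) (\<lambda>T. f T ^ m)"
  by (induction m) (auto intro: represents_one represents_mult)

lemma represents_JM: "represents (Suc n) (JM (Suc n)) last_content"
  using represents.JM[OF represents_one[of "Suc n"]] by simp

text \<open>Both sides satisfy the same recursion in \<open>n\<close>, see \<open>JM_moment_rec\<close> and
  \<open>trans_moment_rec\<close>.\<close>

lemma represents_JM_moment:
  "n < L \<Longrightarrow> represents n (JM_moment n m) (\<lambda>T. trans_moment L m (shape T))"
proof (induction n arbitrary: m)
  case 0
  have anti: "antimono (\<lambda>_ :: nat. 0 :: nat)" by (rule antimonoI) simp
  \<comment> \<open>Only row 0 of the empty partition is addable, and its content is 0, matching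
    \<open>JM 1 = 0\<close>.\<close>
  have "trans_moment L m (\<lambda>_. 0) = 0 ^ m"
  proof (cases m)
    case 0
    then show ?thesis using sum_trans_weight(1)[OF anti, of L] \<open>0 < L\<close> by (simp add: trans_moment_def)
  next
    case (Suc k)
    have "trans_weight L (\<lambda>_. 0) i * row_content (\<lambda>_. 0) i ^ m = 0" if "i < L" for i
    proof (cases i)
      case (Suc j)
      then show ?thesis using trans_weight_not_addable[OF anti that] by (simp add: addable_def)
    qed (simp add: row_content_def \<open>m = Suc k\<close>)
    then have "trans_moment L m (\<lambda>_. 0) = 0" unfolding trans_moment_def by (intro sum.neutral) simp
    then show ?thesis using Suc by simp
  qed
  then have "represents 0 (Poly_Mapping.single 0 (0 ^ m)) (\<lambda>T. trans_moment L m (shape T))"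
    by (intro represents.cong[OF represents.base]) (simp add: paths_0)
  moreover have "JM_moment 0 m = Poly_Mapping.single 0 (0 ^ m)"
    by (cases m) (simp_all add: JM_moment_def JM_1)
  ultimately show ?case by simp
next
  case (Suc n)
  have low: "represents (Suc n) (JM_moment n m) (\<lambda>T. trans_moment L m (shape (tl T)))" for m
    using represents.lift[OF Suc.IH[of m]] Suc.prems by simp
  have init: "trans_moment L 0 (shape T) = 1 \<and> trans_moment L (Suc 0) (shape T) = 0" if "T \<in> paths (Suc n)" for T
    using that Suc.prems sum_trans_weight[OF antimono_shape[of T], of L] shape_eq_0[of T "L - 1"]
    by (simp add: trans_moment_def paths_def)
  \<comment> \<open>Two consecutive moments are carried along because the recursion has order
    two.\<close>
  have "represents (Suc n) (JM_moment (Suc n) m) (\<lambda>T. trans_moment L m (shape T)) \<and>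
    represents (Suc n) (JM_moment (Suc n) (Suc m)) (\<lambda>T. trans_moment L (Suc m) (shape T))"
  proof (induction m)
    case 0
    have "represents (Suc n) 1 (\<lambda>T. trans_moment L 0 (shape T))"
      by (rule represents.cong[OF represents_one]) (simp add: init)
    moreover have "represents (Suc n) 0 (\<lambda>T. trans_moment L (Suc 0) (shape T))"
      by (rule represents.cong[of _ _ "\<lambda>_. 0"]) (use represents_const[of "Suc n" 0] in \<open>simp_all add: init\<close>)
    ultimately show ?case by simp
  next
    case (Suc m)
    define g where "g = (\<lambda>m T. trans_moment L m (shape T))"
    define g' where "g' = (\<lambda>m T. trans_moment L m (shape (tl T)))"
    have h: "represents (Suc n) (JM_moment (Suc n) m) (g m)" "represents (Suc n) (JM_moment (Suc n) (Suc m)) (g (Suc m))"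
       "\<And>k. represents (Suc n) (JM_moment n k) (g' k)"
      using Suc low by (auto simp: g_def g'_def)
    have "represents (Suc n) (JM_moment (Suc n) (Suc (Suc m)))
      (\<lambda>T. g' (Suc (Suc m)) T + (g (Suc m) T - g' (Suc m) T) * last_content T
         + (g (Suc m) T - g' (Suc m) T) * last_content T - (g m T - g' m T) * last_content T * last_content T + g m T)"
      unfolding JM_moment_rec
      by (intro represents.add represents_diff represents.JM h)
    moreover have "g' (Suc (Suc m)) T + (g (Suc m) T - g' (Suc m) T) * last_content T
         + (g (Suc m) T - g' (Suc m) T) * last_content T - (g m T - g' m T) * last_content T * last_content T + g m T
        = g (Suc (Suc m)) T" if "T \<in> paths (Suc n)" for T
    proof -
      obtain k U where T: "T = k # U" and U: "U \<in> paths n" "addable (shape U) k"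
        using \<open>T \<in> paths (Suc n)\<close> by (auto simp: paths_def length_Suc_conv)
      have "k < L" using addable_shape_less[OF U(1) _ U(2)] \<open>Suc n < L\<close> by simp
      moreover have "antimono (shape U)" using U by (simp add: paths_def antimono_shape)
      ultimately show ?thesis using trans_moment_rec[OF _ U(2), of L m] by (simp add: g_def g'_def T)
    qed
    ultimately have "represents (Suc n) (JM_moment (Suc n) (Suc (Suc m))) (g (Suc (Suc m)))"
      by (rule represents.cong)
    then show ?case using Suc by (simp add: g_def)
  qed
  then show ?case by simp
qed

text \<open>Projecting to \<open>n\<close> points keeps the coefficient of the identity and replaces
  the powers of \<open>JM (Suc n)\<close> by their moments, which amounts to averaging over the last
  step of the path.\<close>

theorem lookup_represents:
  "n < L \<Longrightarrow> represents n X f \<Longrightarrow> Poly_Mapping.lookup X 0 = (\<Sum>T\<in>paths n. path_weight L T * f T)"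
proof (induction n arbitrary: X f)
  case 0
  then show ?case using represents_0[OF 0(2)] by (simp add: paths_0 lookup_single)
next
  case (Suc n)
  from Suc.prems(2)
  \<comment> \<open>The extra factor \<open>JM (Suc n) ^ m\<close> makes the induction work: the
    rule \<open>JM\<close> raises \<open>m\<close>, and in the case \<open>lift\<close> the element
    \<open>X\<close> lives on \<open>n\<close> points and can be pulled out of the
    projection.\<close>
  have "Poly_Mapping.lookup (X * JM (Suc n) ^ m) 0
      = (\<Sum>T\<in>paths (Suc n). path_weight L T * (f T * last_content T ^ m))" for m
  proof (induction "Suc n" X f arbitrary: m rule: represents.induct)
    case (lift X f)
    have "n < L" using Suc.prems by simp
    have "Poly_Mapping.lookup (X * JM (Suc n) ^ m) 0 = Poly_Mapping.lookup (proj n (X * JM (Suc n) ^ m)) 0"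
      by (simp add: lookup_proj)
    also have "\<dots> = Poly_Mapping.lookup (X * JM_moment n m) 0"
      using represents_subalg[OF lift(1)] by (simp add: proj_mult_left JM_moment_def)
    also have "\<dots> = (\<Sum>T\<in>paths n. path_weight L T * (f T * trans_moment L m (shape T)))"
      using Suc.IH[OF \<open>n < L\<close> represents_mult[OF lift(1) represents_JM_moment[OF \<open>n < L\<close>]]] .
    also have "\<dots> = (\<Sum>T\<in>paths n. \<Sum>i | i < L \<and> addable (shape T) i.
        path_weight L (i # T) * (f (tl (i # T)) * last_content (i # T) ^ m))"
    proof (rule sum.cong)
      fix T assume T: "T \<in> paths n"
      then have anti: "antimono (shape T)" by (simp add: paths_def antimono_shape)
      have "trans_moment L m (shape T) = (\<Sum>i | i < L \<and> addable (shape T) i. trans_weight L (shape T) i * row_content (shape T) i ^ m)"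
        unfolding trans_moment_def
        by (rule sum.mono_neutral_right) (auto simp: trans_weight_not_addable[OF anti])
      then show "path_weight L T * (f T * trans_moment L m (shape T)) = (\<Sum>i | i < L \<and> addable (shape T) i.
        path_weight L (i # T) * (f (tl (i # T)) * last_content (i # T) ^ m))"
        by (simp add: sum_distrib_left algebra_simps)
    qed simp
    finally show ?case unfolding sum_paths_Suc[OF \<open>n < L\<close>] .
  next
    case (add X f Y g)
    then show ?case by (simp add: distrib_right distrib_left lookup_add sum.distrib)
  next
    case (JM X f)
    show ?case using JM(2)[of "Suc m"] by (simp add: mult.assoc)
  next
    case (cong X f g)
    then show ?case by (auto intro!: sum.cong)
  qed
  from this[of 0] show ?case by simp
qed

section \<open>Cycles and products of Jucys--Murphy elements\<close>

lemma orbit_eq_if_mem: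
  assumes "permutation p" "y \<in> orbit p x"
  shows "orbit p y = orbit p x"
  by (rule orbit_cyclic_eq3[OF cyclic_on_orbit'[OF assms(1)] assms(2)])

text \<open>Composing with the transposition of \<open>m\<close> and its preimage \<open>j\<close>
  makes \<open>m\<close> a fixed point and sends \<open>j\<close> to the old image of
  \<open>m\<close>, so \<open>m\<close> is cut out of its cycle.\<close>

lemma orbit_comp_transpose:
  fixes m :: nat
  assumes "inj p" "p j = m" "j \<noteq> m" "x \<noteq> m"
  shows "orbit (p \<circ> transpose j m) x = orbit p x - {m}"
proof -
  define q where "q = p \<circ> transpose j m"
  have q: "q j = p m" "q m = m" "z \<noteq> j \<Longrightarrow> z \<noteq> m \<Longrightarrow> q z = p z" for z
    using assms by (auto simp: q_def)
  have ne: "z \<noteq> j \<Longrightarrow> p z \<noteq> m" for z using assms by (metis injD)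
  have step: "q z \<in> orbit p x - {m}" if "z \<in> insert x (orbit p x)" "z \<noteq> m" for z
  proof (cases "z = j")
    case True
    then have "m \<in> orbit p x" using that assms(2) by (auto intro: orbit.intros)
    then have "p m \<in> orbit p x" by (auto intro: orbit.intros)
    then show ?thesis using True q(1) ne[of m] assms(3) by auto
  next
    case False
    then show ?thesis using q(3) ne that by (auto intro: orbit.intros)
  qed
  have "y \<in> orbit p x - {m}" if "y \<in> orbit q x" for y
    using that by induction (use step assms(4) in auto)
  \<comment> \<open>Where \<open>p\<close> passes through \<open>m\<close>, the new map jumps from
    \<open>j\<close> to the successor of \<open>m\<close>. The invariant at \<open>m\<close> is
    therefore that \<open>j\<close> has been reached or is the starting point.\<close>
  moreover have "(y \<noteq> m \<longrightarrow> y \<in> orbit q x) \<and> (y = m \<longrightarrow> j \<in> insert x (orbit q x))" if "y \<in> orbit p x" for y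
    using that
  proof induction
    case base
    show ?case using q(3)[of x] ne[of x] assms by (metis insertCI orbit.base)
  next
    case (step z)
    show ?case
    proof (cases "z = m")
      case True
      then have "j \<in> insert x (orbit q x)" using step by simp
      then have "q j \<in> orbit q x" by (auto intro: orbit.intros)
      then show ?thesis using True q(1) ne[of m] assms(3) by auto
    next
      case False
      then have "z \<in> orbit q x" using step by simp
      then show ?thesis using False q(3)[of z] ne[of z] assms(2) by (metis insertCI orbit.step)
    qed
  qed
  ultimately show ?thesis unfolding q_def[symmetric] by auto
qed

lemma num_cycles_comp_transpose:
  assumes p: "p permutes {1..Suc n}" and j: "p j = Suc n" "j \<in> {1..n}"
  shows "num_cycles n (p \<circ> transpose j (Suc n)) = num_cycles (Suc n) p"
proof -
  have perm: "permutation p" using p permutation_permutes by blast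
  have inj: "inj p" using p permutes_inj by blast
  let ?d = "\<lambda>B. B - {Suc n}"
  have self: "y \<in> orbit p y" for y using permutation_self_in_orbit[OF perm] .
  have last: "orbit p (Suc n) = orbit p j"
    by (rule orbit_eq_if_mem[OF perm]) (use j in \<open>metis orbit.base\<close>)
  have img: "orbit p ` {1..Suc n} = orbit p ` {1..n}"
    using last j(2) by (force simp: atLeastAtMostSuc_conv)
  have "orbit (p \<circ> transpose j (Suc n)) ` {1..n} = ?d ` (orbit p ` {1..n})"
    unfolding image_image using orbit_comp_transpose[OF inj j(1)] j(2) by (intro image_cong) auto
  \<comment> \<open>Every cycle in question contains a point of \<open>{1..n}\<close>, which
    survives the deletion and identifies the cycle.\<close>
  moreover have "inj_on ?d (orbit p ` {1..n})"
  proof (rule inj_onI)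
    fix B C assume "B \<in> orbit p ` {1..n}" "C \<in> orbit p ` {1..n}" and eq: "B - {Suc n} = C - {Suc n}"
    then obtain x y where x: "B = orbit p x" "x \<in> {1..n}" and y: "C = orbit p y" by auto
    have "x \<in> B - {Suc n}" using x self[of x] by simp
    then have "x \<in> orbit p y" unfolding eq y by simp
    then show "B = C" unfolding x y by (rule orbit_eq_if_mem[OF perm])
  qed
  ultimately show ?thesis unfolding num_cycles_def img by (simp add: card_image)
qed

lemma num_cycles_fixed:
  assumes "p permutes {1..n}"
  shows "num_cycles (Suc n) p = Suc (num_cycles n p)"
proof -
  have "p (Suc n) = Suc n" using assms by (simp add: permutes_def)
  then have "orbit p (Suc n) = {Suc n}" by (simp add: orbit_eq_singleton_iff)
  moreover have "{Suc n} \<notin> orbit p ` {1..n}"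
    using permutes_orbit_subset[OF assms] by fastforce
  ultimately show ?thesis by (simp add: num_cycles_def atLeastAtMostSuc_conv)
qed

lemma uminus_tr: "- tr i j = tr i j"
  by (metis minus_unique tr_tr)

lemma lookup_mult_single:
  fixes X :: galg
  shows "Poly_Mapping.lookup (X * Poly_Mapping.single q c) p = Poly_Mapping.lookup X (p - q) * c"
proof (induction X rule: galg_induct[OF subset_UNIV])
  case (2 p' d)
  have "p' + q = p \<longleftrightarrow> p' = p - q" by (auto simp: eq_diff_eq)
  then show ?case by (simp add: mult_single lookup_single when_def)
qed (simp_all add: distrib_right lookup_add)

lemma lookup_\<delta>_mult: "Poly_Mapping.lookup (\<delta> q * X) 0 = Poly_Mapping.lookup X (- q)"
proof (induction X rule: galg_induct[OF subset_UNIV])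
  case (2 p' d)
  have "q + p' = 0 \<longleftrightarrow> p' = - q" by (metis add_eq_0_iff)
  then show ?case by (simp add: mult_single lookup_single when_def \<delta>_def)
qed (simp_all add: distrib_left lookup_add)

section \<open>Jucys' product formula\<close>

primrec JM_prod :: "rat \<Rightarrow> nat \<Rightarrow> galg" where
  "JM_prod t 0 = 1"
| "JM_prod t (Suc n) = JM_prod t n * (Poly_Mapping.single 0 t + JM (Suc n))"

text \<open>A permutation of \<open>n + 1\<close> points either fixes \<open>n + 1\<close>, which
  adds a cycle and a factor \<open>t\<close>, or is \<open>q\<close> times \<open>(j, n + 1)\<close>
  for exactly one \<open>q\<close> on \<open>n\<close> points and one \<open>j\<close>, the preimage
  of \<open>n + 1\<close>; then \<open>n + 1\<close> joins an existing cycle.\<close>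

theorem lookup_JM_prod:
  "Poly_Mapping.lookup (JM_prod t n) p = (if p \<in> symgrp n then t ^ num_cycles n (app p) else 0)"
proof (induction n arbitrary: p)
  case 0
  then show ?case by (simp add: symgrp_0 lookup_one num_cycles_def)
next
  case (Suc n)
  define m where "m = Suc n"
  have eq: "Poly_Mapping.lookup (JM_prod t (Suc n)) p
      = Poly_Mapping.lookup (JM_prod t n) p * t + (\<Sum>j\<in>{1..n}. Poly_Mapping.lookup (JM_prod t n) (p + tr j m))"
    unfolding m_def
    by (simp add: distrib_left lookup_add lookup_mult_single JM_def sum_distrib_left lookup_sum \<delta>_def
        diff_conv_add_uminus uminus_tr atLeastLessThanSuc_atLeastAtMost del: add_uminus_conv_diff)
  have grp: "p + tr j m \<in> symgrp n \<longleftrightarrow> p \<in> symgrp m \<and> app p j = m" if "j \<in> {1..n}" for j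
  proof
    assume a: "p + tr j m \<in> symgrp n"
    then have "p + tr j m \<in> symgrp m" using symgrp_mono[of n m] by (auto simp: m_def)
    then have "p \<in> symgrp m" using that by (subst (asm) symgrp_plus_right_iff) (auto simp: m_def intro!: tr_in_symgrp)
    moreover have "app (p + tr j m) m = m" using a unfolding symgrp_iff m_def by (metis atLeastAtMost_iff not_less_eq_eq order_refl)
    ultimately show "p \<in> symgrp m \<and> app p j = m" by simp
  next
    assume a: "p \<in> symgrp m \<and> app p j = m"
    show "p + tr j m \<in> symgrp n" unfolding symgrp_iff
    proof (intro allI impI)
      fix x assume x: "x \<notin> {1..n}"
      then have "x = m \<or> x \<notin> {1..m} \<and> x \<noteq> j \<and> x \<noteq> m" using that by (auto simp: m_def)
      then show "app (p + tr j m) x = x" using a by (auto simp: symgrp_iff)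
    qed
  qed
  show ?case
  proof (cases "p \<in> symgrp m")
    case False
    then have "p \<notin> symgrp n" using symgrp_mono[of n m] by (auto simp: m_def)
    then show ?thesis unfolding eq using False grp by (simp add: Suc m_def)
  next
    case True
    then have perm: "app p permutes {1..m}" by (simp add: symgrp_def)
    show ?thesis
    proof (cases "app p m = m")
      case fixm: True
      have pn: "p \<in> symgrp n" unfolding symgrp_iff
      proof (intro allI impI)
        fix x assume "x \<notin> {1..n}"
        then have "x = m \<or> x \<notin> {1..m}" by (auto simp: m_def)
        then show "app p x = x" using True fixm by (auto simp: symgrp_iff)
      qed
      have "app p j \<noteq> m" if "j \<in> {1..n}" for j
        using fixm that app_eq_iff[of p j m] by (auto simp: m_def)
      then have "(\<Sum>j\<in>{1..n}. Poly_Mapping.lookup (JM_prod t n) (p + tr j m)) = 0"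
        using grp by (intro sum.neutral) (auto simp: Suc)
      moreover have "num_cycles (Suc n) (app p) = Suc (num_cycles n (app p))"
        using pn by (intro num_cycles_fixed) (simp add: symgrp_def)
      ultimately show ?thesis unfolding eq using pn True by (simp add: Suc m_def)
    next
      case False
      then have pn: "p \<notin> symgrp n" by (auto simp: symgrp_iff m_def intro!: exI[of _ "Suc n"])
      have "m \<in> app p ` {1..m}" unfolding permutes_image[OF perm] by (simp add: m_def)
      then obtain i where i: "app p i = m" "i \<in> {1..m}" by auto
      then have i': "i \<in> {1..n}" using False by (auto simp: m_def le_Suc_eq)
      have "Poly_Mapping.lookup (JM_prod t n) (p + tr j m) = (if j = i then t ^ num_cycles n (app (p + tr i m)) else 0)"
        if "j \<in> {1..n}" for j
        using grp[OF that] grp[OF i'] i True app_eq_iff[of p j i] by (auto simp: Suc)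
      then have "(\<Sum>j\<in>{1..n}. Poly_Mapping.lookup (JM_prod t n) (p + tr j m)) = t ^ num_cycles n (app (p + tr i m))"
        using i' by simp
      moreover have "num_cycles n (app (p + tr i m)) = num_cycles m (app p)"
        using num_cycles_comp_transpose[of "app p" n i] perm i i' by (simp add: m_def)
      ultimately show ?thesis unfolding eq using pn True by (simp add: Suc m_def)
    qed
  qed
qed

section \<open>Sequences of star transpositions as words\<close>

lemma JM_power:
  "JM n ^ r = (\<Sum>js | length js = r \<and> set js \<subseteq> {1..<n}. \<delta> (sum_list (map (\<lambda>j. tr j n) js)))"
proof (induction r)
  case 0
  have "{js. length js = 0 \<and> set js \<subseteq> {1..<n}} = {[]}" by auto
  then show ?case by (simp add: \<delta>_zero)
next
  case (Suc r)
  have eq: "{js. length js = Suc r \<and> set js \<subseteq> {1..<n}}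
      = (\<lambda>(j, js). j # js) ` ({1..<n} \<times> {js. length js = r \<and> set js \<subseteq> {1..<n}})"
    by (auto simp: length_Suc_conv image_iff)
  have inj: "inj_on (\<lambda>(j, js). j # js) A" for A :: "(nat \<times> nat list) set" by (auto simp: inj_on_def)
  have "JM n ^ Suc r = (\<Sum>j\<in>{1..<n}. \<delta> (tr j n)) * JM n ^ r" by (simp add: JM_def)
  also have "\<dots> = (\<Sum>(j, js)\<in>{1..<n} \<times> {js. length js = r \<and> set js \<subseteq> {1..<n}}. \<delta> (sum_list (map (\<lambda>j. tr j n) (j # js))))"
    unfolding Suc sum_product by (simp add: \<delta>_mult sum.cartesian_product)
  also have "\<dots> = (\<Sum>js | length js = Suc r \<and> set js \<subseteq> {1..<n}. \<delta> (sum_list (map (\<lambda>j. tr j n) js)))"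
    unfolding eq by (subst sum.reindex[OF inj]) (simp add: case_prod_unfold)
  finally show ?case .
qed

lemma perm_product_star: "perm_product (map (\<lambda>j. transpose j n) js) = app (sum_list (map (\<lambda>j. tr j n) js))"
  by (induction js) (simp_all add: perm_product_def)

theorem star_factorizations_gf:
  "(\<Sum>\<tau>s | length \<tau>s = r \<and> set \<tau>s \<subseteq> star_transpositions n. t ^ num_cycles n (perm_product \<tau>s))
    = Poly_Mapping.lookup (JM n ^ r * JM_prod t n) 0"
proof -
  let ?J = "{js. length js = r \<and> set js \<subseteq> {1..<n}}"
  let ?p = "\<lambda>js. sum_list (map (\<lambda>j. tr j n) js)"
  have star: "star_transpositions n = (\<lambda>j. transpose j n) ` {1..<n}"
    by (force simp: star_transpositions_def)
  have injt: "inj_on (\<lambda>j. transpose j n) {1..<n}"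
    by (rule inj_onI) (metis transpose_apply_second)
  have bij: "bij_betw (map (\<lambda>j. transpose j n)) ?J {\<tau>s. length \<tau>s = r \<and> set \<tau>s \<subseteq> star_transpositions n}"
    unfolding bij_betw_def
  proof
    show "inj_on (map (\<lambda>j. transpose j n)) ?J"
    proof (rule inj_onI)
      fix x y assume "x \<in> ?J" "y \<in> ?J" "map (\<lambda>j. transpose j n) x = map (\<lambda>j. transpose j n) y"
      then show "x = y" using map_inj_on[OF _ inj_on_subset[OF injt], of x y] by simp
    qed
    show "map (\<lambda>j. transpose j n) ` ?J = {\<tau>s. length \<tau>s = r \<and> set \<tau>s \<subseteq> star_transpositions n}"
    proof (intro equalityI subsetI)
      fix \<tau>s assume "\<tau>s \<in> {\<tau>s. length \<tau>s = r \<and> set \<tau>s \<subseteq> star_transpositions n}"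
      then have "\<tau>s \<in> lists ((\<lambda>j. transpose j n) ` {1..<n})" "length \<tau>s = r" by (auto simp: star)
      then show "\<tau>s \<in> map (\<lambda>j. transpose j n) ` ?J" unfolding lists_image by auto
    qed (fastforce simp: star)
  qed
  have grp: "?p js \<in> symgrp n" if "set js \<subseteq> {1..<n}" for js
    using that by (induction js) (auto intro!: symgrp_plus tr_in_symgrp)
  have "(\<Sum>\<tau>s | length \<tau>s = r \<and> set \<tau>s \<subseteq> star_transpositions n. t ^ num_cycles n (perm_product \<tau>s))
      = (\<Sum>js\<in>?J. t ^ num_cycles n (app (?p js)))"
    unfolding sum.reindex_bij_betw[OF bij, symmetric] perm_product_star ..
  \<comment> \<open>The coefficient of the identity pairs each word with its inverse; a permutation
    and its inverse have the same orbits, hence equally many cycles.\<close>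
  also have "\<dots> = (\<Sum>js\<in>?J. Poly_Mapping.lookup (JM_prod t n) (- ?p js))"
    using grp by (intro sum.cong)
      (auto simp: lookup_JM_prod symgrp_uminus num_cycles_def app_uminus orbit_inv_eq permutation_app)
  also have "\<dots> = Poly_Mapping.lookup (JM n ^ r * JM_prod t n) 0"
    by (simp add: JM_power sum_distrib_right lookup_sum lookup_\<delta>_mult)
  finally show ?thesis .
qed

primrec content_prod :: "rat \<Rightarrow> nat list \<Rightarrow> rat" where
  "content_prod t [] = 1"
| "content_prod t (i # T) = content_prod t T * (t + row_content (shape T) i)"

lemma represents_JM_prod: "represents n (JM_prod t n) (content_prod t)"
proof (induction n)
  case 0
  have "represents 0 (Poly_Mapping.single 0 1) (content_prod t)"
    by (rule represents.cong[OF represents.base]) (simp add: paths_0)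
  then show ?case by simp
next
  case (Suc n)
  have "represents (Suc n) (JM_prod t (Suc n)) (\<lambda>T. content_prod t (tl T) * (t + last_content T))"
    using represents_mult[OF represents.lift[OF Suc] represents.add[OF represents_const represents_JM]] by simp
  then show ?case by (rule represents.cong) (auto simp: paths_def length_Suc_conv)
qed

theorem star_factorizations_path_sum:
  assumes "n \<ge> 1" "n < L"
  shows "(\<Sum>\<tau>s | length \<tau>s = r \<and> set \<tau>s \<subseteq> star_transpositions n. t ^ num_cycles n (perm_product \<tau>s))
    = (\<Sum>T\<in>paths n. path_weight L T * (last_content T ^ r * content_prod t T))"
proof -
  obtain m where "n = Suc m" using assms(1) by (cases n) auto
  then have "represents n (JM n ^ r * JM_prod t n) (\<lambda>T. last_content T ^ r * content_prod t T)"
    using represents_mult[OF represents_power[OF represents_JM] represents_JM_prod] by simp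
  then show ?thesis using lookup_represents[OF assms(2)] star_factorizations_gf by simp
qed

section \<open>Frobenius' formula\<close>

definition young :: "nat \<Rightarrow> nat \<Rightarrow> (nat \<Rightarrow> nat) set" where
  "young L n = {\<nu>. antimono \<nu> \<and> (\<forall>i\<ge>L. \<nu> i = 0) \<and> (\<Sum>i<L. \<nu> i) = n}"

definition removable :: "(nat \<Rightarrow> nat) \<Rightarrow> nat \<Rightarrow> bool" where
  "removable \<nu> i \<longleftrightarrow> \<nu> (Suc i) < \<nu> i"

abbreviation rem_box :: "(nat \<Rightarrow> nat) \<Rightarrow> nat \<Rightarrow> nat \<Rightarrow> nat" where
  "rem_box \<nu> i \<equiv> \<nu>(i := \<nu> i - 1)"

lemma young_0: "young L 0 = {\<lambda>_. 0}"
proof (intro equalityI subsetI)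
  fix \<nu> assume "\<nu> \<in> young L 0"
  then have "\<nu> i = 0" for i by (cases "i < L") (auto simp: young_def)
  then show "\<nu> \<in> {\<lambda>_. 0}" by auto
qed (auto simp: young_def intro: antimonoI)

lemma sum_fun_upd:
  fixes \<nu> :: "nat \<Rightarrow> nat"
  shows "i < L \<Longrightarrow> (\<Sum>j<L. (\<nu>(i := x)) j) + \<nu> i = (\<Sum>j<L. \<nu> j) + x"
  by (simp add: sum.remove[of "{..<L}" i])

lemma removable_less: "\<nu> \<in> young L n \<Longrightarrow> removable \<nu> i \<Longrightarrow> i < L"
  by (rule ccontr) (auto simp: young_def removable_def)

lemma removable_add_box: "antimono \<nu> \<Longrightarrow> removable (add_box \<nu> i) i"
  using antimonoD[of \<nu> i "Suc i"] by (simp add: removable_def)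

lemma rem_box_young:
  assumes "\<nu> \<in> young L (Suc n)" "removable \<nu> i"
  shows "rem_box \<nu> i \<in> young L n" "addable (rem_box \<nu> i) i" "add_box (rem_box \<nu> i) i = \<nu>"
proof -
  have \<nu>: "antimono \<nu>" using assms(1) by (simp add: young_def)
  have i: "i < L" "\<nu> i > 0" using removable_less[OF assms] assms(2) by (auto simp: removable_def)
  have "antimono (rem_box \<nu> i)"
  proof (rule antimonoI)
    fix x y :: nat assume "x \<le> y"
    then show "rem_box \<nu> i y \<le> rem_box \<nu> i x"
      using antimonoD[OF \<nu> \<open>x \<le> y\<close>] antimonoD[OF \<nu>, of "Suc i" y] assms(2)
      by (cases "x = y") (auto simp: removable_def)
  qed
  moreover have "(\<Sum>j<L. (rem_box \<nu> i) j) = n"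
    using sum_fun_upd[OF i(1), of \<nu> "\<nu> i - 1"] assms(1) i(2) by (simp add: young_def)
  ultimately show "rem_box \<nu> i \<in> young L n" using assms(1) by (auto simp: young_def)
  show "addable (rem_box \<nu> i) i" using antimonoD[OF \<nu>, of "i - 1" i] i(2) by (auto simp: addable_def)
  show "add_box (rem_box \<nu> i) i = \<nu>" using i(2) by auto
qed

lemma finite_removable: "\<nu> \<in> young L n \<Longrightarrow> finite {i. removable \<nu> i}"
  using removable_less by (metis (mono_tags, lifting) bounded_nat_set_is_finite mem_Collect_eq)

section \<open>The branching rule and path counts\<close>

text \<open>By recursion on the size this rule determines \<open>d\<close> on partitions with at
  most \<open>L\<close> rows. It serves to identify path counts, tableau counts and Frobenius'
  formula with each other.\<close>

definition branching :: "nat \<Rightarrow> ((nat \<Rightarrow> nat) \<Rightarrow> rat) \<Rightarrow> bool" where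
  "branching L d \<longleftrightarrow> d (\<lambda>_. 0) = 1 \<and>
     (\<forall>n. \<forall>\<nu>\<in>young L (Suc n). d \<nu> = (\<Sum>i | removable \<nu> i. d (rem_box \<nu> i)))"

lemma branching_unique:
  assumes "branching L d" "branching L d'" "\<nu> \<in> young L n"
  shows "d \<nu> = d' \<nu>"
  using assms(3)
proof (induction n arbitrary: \<nu>)
  case 0
  then show ?case using assms(1,2) by (simp add: young_0 branching_def)
next
  case (Suc n)
  have "d \<nu> = (\<Sum>i | removable \<nu> i. d (rem_box \<nu> i))" "d' \<nu> = (\<Sum>i | removable \<nu> i. d' (rem_box \<nu> i))"
    using assms(1,2) Suc.prems unfolding branching_def by blast+
  moreover have "d (rem_box \<nu> i) = d' (rem_box \<nu> i)" if "removable \<nu> i" for i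
    using Suc.IH[OF rem_box_young(1)[OF Suc.prems that]] .
  ultimately show ?case by simp
qed

definition path_set :: "(nat \<Rightarrow> nat) \<Rightarrow> nat list set" where
  "path_set \<nu> = {T. is_path T \<and> shape T = \<nu>}"

lemma shape_eq_count_list: "shape T i = count_list T i"
  by (induction T) auto

lemma shape_in_young: "T \<in> paths n \<Longrightarrow> n \<le> L \<Longrightarrow> shape T \<in> young L n"
proof -
  assume T: "T \<in> paths n" "n \<le> L"
  then have 0: "\<forall>i\<ge>L. shape T i = 0" using shape_eq_0[of T] by (auto simp: paths_def)
  then have "set T \<subseteq> {..<L}" by (metis count_list_0_iff lessThan_iff linorder_not_le shape_eq_count_list subsetI)
  then show ?thesis using T 0 antimono_shape[of T] sum_count_set[of T "{..<L}"]
    by (simp add: young_def paths_def shape_eq_count_list)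
qed

lemma path_set_subset_paths: "\<nu> \<in> young L n \<Longrightarrow> path_set \<nu> \<subseteq> paths n"
proof
  fix T assume \<nu>: "\<nu> \<in> young L n" and T: "T \<in> path_set \<nu>"
  then have "set T \<subseteq> {..<L}"
    by (auto simp: path_set_def young_def) (metis count_list_0_iff linorder_not_le shape_eq_count_list)
  then have "(\<Sum>i<L. shape T i) = length T"
    using sum_count_set[of T "{..<L}"] by (simp add: shape_eq_count_list)
  then show "T \<in> paths n" using \<nu> T by (auto simp: path_set_def young_def paths_def)
qed

lemma finite_path_set: "\<nu> \<in> young L n \<Longrightarrow> finite (path_set \<nu>)"
  using path_set_subset_paths finite_paths finite_subset by metis

lemma path_set_Suc:
  assumes "\<nu> \<in> young L (Suc n)"
  shows "path_set \<nu> = (\<lambda>(i, T). i # T) ` (SIGMA i:{i. removable \<nu> i}. path_set (rem_box \<nu> i))"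
proof (intro equalityI subsetI)
  fix T assume T: "T \<in> path_set \<nu>"
  then have "T \<in> paths (Suc n)" using path_set_subset_paths[OF assms] by auto
  then obtain i U where iU: "T = i # U" "is_path U" by (auto simp: paths_def length_Suc_conv)
  then have \<nu>: "\<nu> = add_box (shape U) i" using T by (auto simp: path_set_def)
  then have "removable \<nu> i" using removable_add_box[OF antimono_shape[OF iU(2)]] by simp
  moreover have "U \<in> path_set (rem_box \<nu> i)" using \<nu> iU by (simp add: path_set_def)
  ultimately show "T \<in> (\<lambda>(i, T). i # T) ` (SIGMA i:{i. removable \<nu> i}. path_set (rem_box \<nu> i))"
    using iU by auto
next
  fix T assume "T \<in> (\<lambda>(i, T). i # T) ` (SIGMA i:{i. removable \<nu> i}. path_set (rem_box \<nu> i))"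
  then obtain i U where T: "T = i # U" "removable \<nu> i" "U \<in> path_set (rem_box \<nu> i)" by auto
  then show "T \<in> path_set \<nu>"
    using rem_box_young(2,3)[OF assms T(2)] by (auto simp: path_set_def simp del: fun_upd_apply)
qed

lemma sum_path_set_Suc:
  assumes "\<nu> \<in> young L (Suc n)"
  shows "(\<Sum>T\<in>path_set \<nu>. F T) = (\<Sum>i | removable \<nu> i. \<Sum>T\<in>path_set (rem_box \<nu> i). F (i # T))"
proof -
  have "inj_on (\<lambda>(i, T). i # T) (SIGMA i:{i. removable \<nu> i}. path_set (rem_box \<nu> i))" by (auto simp: inj_on_def)
  moreover have "\<forall>i\<in>{i. removable \<nu> i}. finite (path_set (rem_box \<nu> i))"
    using finite_path_set[OF rem_box_young(1)[OF assms]] by auto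
  ultimately show ?thesis unfolding path_set_Suc[OF assms]
    by (simp add: sum.reindex sum.Sigma[OF finite_removable[OF assms]] case_prod_unfold)
qed

lemma branching_card_path_set: "branching L (\<lambda>\<nu>. of_nat (card (path_set \<nu>)))"
  unfolding branching_def
proof (intro conjI allI ballI)
  have "path_set (\<lambda>_. 0) = {[]}"
  proof -
    have "T = []" if "shape T = (\<lambda>_. 0)" for T
    proof -
      have "count_list T x = 0" for x using fun_cong[OF that, of x] by (simp add: shape_eq_count_list)
      then have "hd T \<notin> set T" by (simp add: count_list_0_iff[symmetric])
      then show ?thesis using hd_in_set by blast
    qed
    then show ?thesis by (auto simp: path_set_def)
  qed
  then show "rat_of_nat (card (path_set (\<lambda>_. 0))) = 1" by simp
  show "rat_of_nat (card (path_set \<nu>)) = (\<Sum>i | removable \<nu> i. of_nat (card (path_set (rem_box \<nu> i))))"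
    if "\<nu> \<in> young L (Suc n)" for \<nu> n
    using sum_path_set_Suc[OF that, of "\<lambda>_. 1 :: rat"] by simp
qed

section \<open>Vandermonde products and Frobenius' formula\<close>

text \<open>Up to a common shift the row contents are the numbers
  \<open>\<nu> i + L - 1 - i\<close>, so this is the usual Vandermonde product of Frobenius'
  formula.\<close>

definition vandermonde :: "nat \<Rightarrow> (nat \<Rightarrow> nat) \<Rightarrow> rat" where
  "vandermonde L \<nu> = (\<Prod>(p, q) | p < q \<and> q < L. row_content \<nu> p - row_content \<nu> q)"

lemma finite_pairs_less: "finite {(p, q). p < q \<and> q < (L :: nat)}"
  by (rule finite_subset[of _ "{..<L} \<times> {..<L}"]) auto

lemma vandermonde_nonzero: "antimono \<nu> \<Longrightarrow> vandermonde L \<nu> \<noteq> 0"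
  by (auto simp: vandermonde_def prod_zero_iff[OF finite_pairs_less] row_content_eq_iff)

text \<open>Only pairs containing \<open>i\<close> change. By antisymmetry of the differences, the
  quotient has the same form whether the other row comes before or after \<open>i\<close>.\<close>

lemma vandermonde_add_box:
  assumes "antimono \<nu>" "i < L"
  shows "vandermonde L (add_box \<nu> i)
    = vandermonde L \<nu> * (\<Prod>j\<in>{..<L} - {i}. 1 + 1 / (row_content \<nu> i - row_content \<nu> j))"
proof -
  define S where "S = {(p, q). p < q \<and> q < L}"
  define r where "r = (\<lambda>(p, q). if p = i then 1 + 1 / (row_content \<nu> i - row_content \<nu> q)
     else if q = i then 1 + 1 / (row_content \<nu> i - row_content \<nu> p) else 1)"
  have "vandermonde L (add_box \<nu> i) = (\<Prod>pq\<in>S. (case pq of (p, q) \<Rightarrow> row_content \<nu> p - row_content \<nu> q) * r pq)"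
    unfolding vandermonde_def S_def
  proof (rule prod.cong, simp, clarify)
    fix p q :: nat assume "p < q" "q < L"
    then have "row_content \<nu> p - row_content \<nu> q \<noteq> 0" "row_content \<nu> q - row_content \<nu> p \<noteq> 0"
      using assms(1) by (auto simp: row_content_eq_iff)
    then show "row_content (add_box \<nu> i) p - row_content (add_box \<nu> i) q
       = (row_content \<nu> p - row_content \<nu> q) * r (p, q)"
      using \<open>p < q\<close>
      by (cases "p = i"; cases "q = i") (auto simp: r_def row_content_add_box divide_simps algebra_simps)
  qed
  also have "\<dots> = vandermonde L \<nu> * (\<Prod>pq\<in>S. r pq)"
    by (simp add: prod.distrib vandermonde_def S_def)
  also have "(\<Prod>pq\<in>S. r pq) = (\<Prod>pq\<in>{(p, q) \<in> S. p = i \<or> q = i}. r pq)"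
    by (rule prod.mono_neutral_right) (auto simp: S_def r_def finite_pairs_less split: if_splits)
  also have "\<dots> = (\<Prod>j\<in>{..<L} - {i}. 1 + 1 / (row_content \<nu> i - row_content \<nu> j))"
    by (rule prod.reindex_bij_witness[where i = "\<lambda>j. if j < i then (j, i) else (i, j)"
          and j = "\<lambda>(p, q). if p = i then q else p"])
      (use assms(2) in \<open>auto simp: S_def r_def\<close>)
  finally show ?thesis .
qed

text \<open>The number of standard tableaux up to a factor that depends only on \<open>L\<close>.\<close>

definition frobenius :: "nat \<Rightarrow> (nat \<Rightarrow> nat) \<Rightarrow> rat" where
  "frobenius L \<nu> = fact (\<Sum>i<L. \<nu> i) * vandermonde L \<nu> / (\<Prod>i<L. fact (\<nu> i + L - 1 - i))"

lemma frobenius_nonzero: "antimono \<nu> \<Longrightarrow> frobenius L \<nu> \<noteq> 0"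
  by (simp add: frobenius_def vandermonde_nonzero)

text \<open>The factor \<open>n + 1\<close> comes from the factorial of the size, the product in
  \<open>trans_weight\<close> from the Vandermonde product, and its denominator from the factorial
  belonging to row \<open>i\<close>.\<close>

lemma frobenius_add_box:
  assumes "\<nu> \<in> young L n" "i < L"
  shows "frobenius L (add_box \<nu> i) = of_nat (Suc n) * trans_weight L \<nu> i * frobenius L \<nu>"
proof -
  have \<nu>: "antimono \<nu>" "(\<Sum>j<L. \<nu> j) = n" using assms(1) by (auto simp: young_def)
  have n: "(\<Sum>j<L. add_box \<nu> i j) = Suc n"
    using sum_fun_upd[OF assms(2), of \<nu> "Suc (\<nu> i)"] \<nu>(2) by simp
  have "(\<Prod>j\<in>{..<L} - {i}. fact (add_box \<nu> i j + L - 1 - j)) = (\<Prod>j\<in>{..<L} - {i}. fact (\<nu> j + L - 1 - j) :: rat)"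
    by (intro prod.cong) auto
  moreover have "Suc (\<nu> i) + L - 1 - i = Suc (\<nu> i + L - 1 - i)" using assms(2) by simp
  moreover have "of_nat (Suc (\<nu> i + L - 1 - i)) = row_content \<nu> i + of_nat L"
    using assms(2) by (simp add: row_content_def of_nat_diff)
  ultimately have F: "(\<Prod>j<L. fact (add_box \<nu> i j + L - 1 - j))
      = (row_content \<nu> i + of_nat L) * (\<Prod>j<L. fact (\<nu> j + L - 1 - j) :: rat)"
    using assms(2) by (simp add: prod.remove[of "{..<L}" i] del: of_nat_Suc)
  show ?thesis
    unfolding frobenius_def F n \<nu>(2) trans_weight_def vandermonde_add_box[OF \<nu>(1) assms(2)]
    by simp
qed

text \<open>By \<open>frobenius_add_box\<close>, removing a box from row \<open>i\<close> multiplies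
  the value by \<open>(c i + L - 1) * A i / (n + 1)\<close>, with the interpolation weights
  \<open>A\<close> for \<open>e = -1\<close>. It remains to see that the terms
  \<open>(c i + L - 1) * A i\<close> add up to \<open>n + 1\<close>.\<close>

lemma branching_frobenius: "branching L (\<lambda>\<nu>. frobenius L \<nu> / frobenius L (\<lambda>_. 0))"
  unfolding branching_def
proof (intro conjI allI ballI)
  have "antimono (\<lambda>_ :: nat. 0 :: nat)" by (rule antimonoI) simp
  then show "frobenius L (\<lambda>_. 0) / frobenius L (\<lambda>_. 0) = 1" using frobenius_nonzero by simp
next
  fix n \<nu> assume \<nu>: "\<nu> \<in> young L (Suc n)"
  define c where "c = row_content \<nu>"
  define A where "A i = (\<Prod>j\<in>{..<L} - {i}. 1 + (- 1) / (c i - c j))" for i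
  have anti: "antimono \<nu>" using \<nu> by (simp add: young_def)
  have "frobenius L (rem_box \<nu> i) = frobenius L \<nu> * ((c i + of_nat L - 1) * A i) / of_nat (Suc n)"
    if i: "removable \<nu> i" for i
  proof -
    note r = rem_box_young[OF \<nu> i]
    define \<kappa> where "\<kappa> = rem_box \<nu> i"
    have \<kappa>: "\<nu> = add_box \<kappa> i" "\<kappa> \<in> young L n" "antimono \<kappa>"
      using r by (auto simp: \<kappa>_def young_def)
    have iL: "i < L" using removable_less[OF \<nu> i] .
    have fr: "frobenius L \<nu> = of_nat (Suc n) * trans_weight L \<kappa> i * frobenius L \<kappa>"
      unfolding \<kappa>(1) by (rule frobenius_add_box[OF \<kappa>(2) iL])
    have c: "row_content \<kappa> i = c i - 1" "j \<noteq> i \<Longrightarrow> row_content \<kappa> j = c j" for j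
      using row_content_add_box[where \<nu> = \<kappa>] by (auto simp: c_def \<kappa>(1))
    \<comment> \<open>With \<open>d = c i - c j\<close> the two factors are
      \<open>1 + 1/(d - 1)\<close> and \<open>1 - 1/d\<close>, which are reciprocal.\<close>
    have "(\<Prod>j\<in>{..<L} - {i}. 1 + 1 / (row_content \<kappa> i - row_content \<kappa> j)) * A i = 1"
      unfolding A_def prod.distrib[symmetric]
    proof (rule prod.neutral, rule ballI)
      fix j assume "j \<in> {..<L} - {i}"
      then have j: "j \<noteq> i" by simp
      then have "c i - c j \<noteq> 0" "c i - 1 - c j \<noteq> 0"
        using row_content_eq_iff[OF anti, of i j] row_content_eq_iff[OF \<kappa>(3), of i j] c(1) c(2)[OF j]
        by (auto simp: c_def)
      then show "(1 + 1 / (row_content \<kappa> i - row_content \<kappa> j)) * (1 + - 1 / (c i - c j)) = 1"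
        unfolding c(1) c(2)[OF j] by (simp add: divide_simps)
    qed
    moreover have "c i + of_nat L - 1 \<noteq> 0" using row_content_gt[OF iL, of \<kappa>] c(1) by simp
    moreover have "row_content \<kappa> i + of_nat L = c i + of_nat L - 1" using c(1) by simp
    moreover have "P / x * (x * A i) = P * A i" if "x \<noteq> 0" for x P :: rat
      using that by simp
    ultimately have w: "trans_weight L \<kappa> i * ((c i + of_nat L - 1) * A i) = 1"
      unfolding trans_weight_def by metis
    have "frobenius L \<nu> * ((c i + of_nat L - 1) * A i)
        = frobenius L \<kappa> * of_nat (Suc n) * (trans_weight L \<kappa> i * ((c i + of_nat L - 1) * A i))"
      unfolding fr by (simp only: ac_simps)
    then have "frobenius L \<kappa> * of_nat (Suc n) = frobenius L \<nu> * ((c i + of_nat L - 1) * A i)"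
      by (simp only: w mult_1_right)
    then show ?thesis unfolding \<kappa>_def by (simp add: divide_simps del: of_nat_Suc)
  qed
  moreover have "(\<Sum>i | removable \<nu> i. (c i + of_nat L - 1) * A i) = of_nat (Suc n)"
  proof -
    \<comment> \<open>A non-removable row below \<open>L\<close> either has a next row of equal
      length below \<open>L\<close>, which makes \<open>A i\<close> vanish, or is the empty row
      \<open>L - 1\<close>, where \<open>c i + L - 1\<close> vanishes.\<close>
    have "(\<Sum>i | removable \<nu> i. (c i + of_nat L - 1) * A i) = (\<Sum>i<L. (c i + of_nat L - 1) * A i)"
    proof (rule sum.mono_neutral_left)
      show "\<forall>i\<in>{..<L} - {i. removable \<nu> i}. (c i + of_nat L - 1) * A i = 0"
      proof
        fix i assume "i \<in> {..<L} - {i. removable \<nu> i}"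
        then have i: "i < L" "\<not> removable \<nu> i" by simp_all
        then have eq: "\<nu> i = \<nu> (Suc i)" using antimonoD[OF anti, of i "Suc i"] by (simp add: removable_def)
        show "(c i + of_nat L - 1) * A i = 0"
        proof (cases "Suc i < L")
          case True
          have "c i - c (Suc i) = 1" using eq by (simp add: c_def row_content_def)
          then have "A i = 0" unfolding A_def using True by (auto simp: prod_zero_iff intro!: bexI[of _ "Suc i"])
          then show ?thesis by simp
        next
          case False
          then have L: "L = Suc i" using i by simp
          then have "\<nu> i = 0" using eq \<nu> by (simp add: young_def)
          then show ?thesis by (simp add: c_def row_content_def L)
        qed
      qed
    qed (use removable_less[OF \<nu>] in auto)
    also have "\<dots> = (\<Sum>i<L. c i * A i) + (of_nat L - 1) * (\<Sum>i<L. A i)"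
      by (simp add: sum_distrib_left sum.distrib[symmetric] algebra_simps)
    \<comment> \<open>One \<open>L choose 2\<close> comes from the interpolation identity and a
      second one from the row indices in the contents; together they cancel
      \<open>(L - 1) * L\<close>.\<close>
    also have "\<dots> = (\<Sum>i<L. c i) - of_nat (L choose 2) + (of_nat L - 1) * of_nat L"
      using sum_interpolation_weights[of "{..<L}" c "-1"] inj_row_content[OF anti] by (simp add: A_def c_def)
    also have "(\<Sum>i<L. c i) = of_nat (Suc n) - of_nat (L choose 2)"
    proof -
      have "(\<Sum>i<L. i) = L choose 2"
        by (induction L) (simp_all add: numeral_2_eq_2)
      from arg_cong[OF this, of rat_of_nat] have "(\<Sum>i<L. of_nat i) = rat_of_nat (L choose 2)" by simp
      moreover have "(\<Sum>i<L. of_nat (\<nu> i)) = rat_of_nat (Suc n)"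
      proof -
        have "(\<Sum>i<L. \<nu> i) = Suc n" using \<nu> by (simp add: young_def)
        from arg_cong[OF this, of rat_of_nat] show ?thesis by (simp del: of_nat_Suc)
      qed
      ultimately show ?thesis by (simp add: c_def row_content_def sum_subtractf del: of_nat_Suc)
    qed
    also have "rat_of_nat (L choose 2) = of_nat L * (of_nat L - 1) / 2"
    proof (induction L)
      case (Suc L)
      then show ?case by (simp add: numeral_2_eq_2) (simp add: field_simps)
    qed (simp add: numeral_2_eq_2)
    finally show ?thesis by (simp add: algebra_simps)
  qed
  ultimately have "(\<Sum>i | removable \<nu> i. frobenius L (rem_box \<nu> i)) = frobenius L \<nu>"
    by (simp add: sum_distrib_left[symmetric] sum_divide_distrib[symmetric] del: of_nat_Suc)
  then show "frobenius L \<nu> / frobenius L (\<lambda>_. 0) = (\<Sum>i | removable \<nu> i. frobenius L (rem_box \<nu> i) / frobenius L (\<lambda>_. 0))"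
    by (simp add: sum_divide_distrib[symmetric])
qed

text \<open>By \<open>frobenius_add_box\<close> the product of transition weights along a path
  telescopes, so it depends only on the final shape.\<close>

lemma path_weight_eq_frobenius:
  "T \<in> paths n \<Longrightarrow> n \<le> L \<Longrightarrow> path_weight L T = frobenius L (shape T) / frobenius L (\<lambda>_. 0) / fact n"
proof (induction n arbitrary: T)
  case 0
  have "antimono (\<lambda>_ :: nat. 0 :: nat)" by (rule antimonoI) simp
  then show ?case using 0 frobenius_nonzero by (simp add: paths_0)
next
  case (Suc n)
  then obtain i U where T: "T = i # U" and U: "U \<in> paths n" "addable (shape U) i"
    by (auto simp: paths_def length_Suc_conv)
  have "i < L" using addable_shape_less[OF U(1) _ U(2)] Suc.prems by simp
  then have "frobenius L (shape T) = of_nat (Suc n) * trans_weight L (shape U) i * frobenius L (shape U)"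
    using frobenius_add_box[OF shape_in_young[OF U(1)], of L i] Suc.prems unfolding T by simp
  moreover have "path_weight L U = frobenius L (shape U) / frobenius L (\<lambda>_. 0) / fact n"
    using Suc.IH[OF U(1)] Suc.prems by simp
  ultimately show ?case unfolding T path_weight.simps fact_Suc by (simp only:) (simp del: of_nat_Suc)
qed

theorem path_weight_eq:
  assumes "branching L d" "T \<in> paths n" "n \<le> L"
  shows "path_weight L T = d (shape T) / fact n"
  using branching_unique[OF assms(1) branching_frobenius shape_in_young[OF assms(2,3)]]
    path_weight_eq_frobenius[OF assms(2,3)] by simp

section \<open>Partitions as multisets and standard tableaux\<close>

text \<open>Cells are numbered from 1 as in \<open>cells\<close>, rows of \<open>\<nu>\<close> from
  0; hence the \<open>a - 1\<close>.\<close>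

definition diagram :: "(nat \<Rightarrow> nat) \<Rightarrow> (nat \<times> nat) set" where
  "diagram \<nu> = {(a, b). 1 \<le> a \<and> 1 \<le> b \<and> b \<le> \<nu> (a - 1)}"

definition parts_of :: "nat \<Rightarrow> (nat \<Rightarrow> nat) \<Rightarrow> nat multiset" where
  "parts_of L \<nu> = filter_mset (\<lambda>x. x \<noteq> 0) (image_mset \<nu> (mset_set {..<L}))"

lemma parts_of_eq_mset: "parts_of L \<nu> = mset (filter (\<lambda>x. x \<noteq> 0) (map \<nu> [0..<L]))"
  by (simp add: parts_of_def atLeast0LessThan)

lemma rows_parts_of:
  assumes "antimono \<nu>"
  shows "rows (parts_of L \<nu>) = filter (\<lambda>x. x \<noteq> 0) (map \<nu> [0..<L])" (is "_ = ?xs")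
proof -
  have "sorted_wrt (\<ge>) (map \<nu> [0..<L])"
    using antimonoD[OF assms] by (auto simp: sorted_wrt_iff_nth_less)
  then have "sorted_wrt (\<ge>) ?xs" by (rule sorted_wrt_filter)
  then have "sorted (rev ?xs)" by (simp add: sorted_wrt_rev)
  then have "sort ?xs = rev ?xs" by (intro properties_for_sort) simp_all
  then show ?thesis unfolding rows_def parts_of_eq_mset sorted_list_of_multiset_mset by simp
qed

lemma cells_parts_of:
  assumes "antimono \<nu>" "\<forall>i\<ge>L. \<nu> i = 0"
  shows "cells (parts_of L \<nu>) = diagram \<nu>"
proof -
  \<comment> \<open>\<open>l\<close> is the number of non-empty rows; by monotonicity the zeros
    removed by the filter are the rows from \<open>l\<close> on.\<close>
  define l where "l = (LEAST i. \<nu> i = 0)"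
  have l0: "\<nu> l = 0" unfolding l_def by (rule LeastI[of _ L]) (use assms(2) in simp)
  have lL: "l \<le> L" unfolding l_def by (rule Least_le) (use assms(2) in simp)
  have pos: "\<nu> i \<noteq> 0" if "i < l" for i using not_less_Least that unfolding l_def by blast
  have zero: "\<nu> i = 0" if "i \<ge> l" for i using antimonoD[OF assms(1) that] l0 by simp
  have "[0..<L] = [0..<l] @ [l..<L]" using lL by (metis le0 le_Suc_ex upt_add_eq_append)
  moreover have "filter (\<lambda>x. x \<noteq> 0) (map \<nu> [0..<l]) = map \<nu> [0..<l]" using pos by (auto simp: filter_id_conv)
  moreover have "filter (\<lambda>x. x \<noteq> 0) (map \<nu> [l..<L]) = []" using zero by (auto simp: filter_empty_conv)
  ultimately have rows: "rows (parts_of L \<nu>) = map \<nu> [0..<l]"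
    unfolding rows_parts_of[OF assms(1)] by simp
  have bound: "a \<le> l" if "1 \<le> a" "1 \<le> b" "b \<le> \<nu> (a - 1)" for a b
    using zero[of "a - 1"] that by (cases "a \<le> l") auto
  have nth: "map \<nu> [0..<l] ! (a - 1) = \<nu> (a - 1)" if "1 \<le> a" "a \<le> l" for a
    using that by simp
  have "(a, b) \<in> cells (parts_of L \<nu>) \<longleftrightarrow> (a, b) \<in> diagram \<nu>" for a b
  proof -
    have "(a, b) \<in> cells (parts_of L \<nu>) \<longleftrightarrow> 1 \<le> a \<and> a \<le> l \<and> 1 \<le> b \<and> b \<le> map \<nu> [0..<l] ! (a - 1)"
      by (simp add: cells_def rows)
    also have "\<dots> \<longleftrightarrow> 1 \<le> a \<and> 1 \<le> b \<and> b \<le> \<nu> (a - 1)" using bound[of a b] nth[of a] by metis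
    finally show ?thesis by (simp add: diagram_def)
  qed
  then show ?thesis by auto
qed

lemma sum_mset_parts_of: "\<Sum>\<^sub># (parts_of L \<nu>) = (\<Sum>i<L. \<nu> i)"
proof -
  have "\<Sum>\<^sub># (filter_mset (\<lambda>x. x \<noteq> 0) M) = \<Sum>\<^sub># M" for M :: "nat multiset"
    by (induction M) auto
  then show ?thesis by (simp add: parts_of_def sum_unfold_sum_mset)
qed

lemma bij_betw_parts_of:
  assumes "n \<le> L"
  shows "bij_betw (parts_of L) (young L n) (partitions n)"
  unfolding bij_betw_def
proof
  show "inj_on (parts_of L) (young L n)"
  proof (rule inj_onI)
    fix \<nu> \<kappa> assume *: "\<nu> \<in> young L n" "\<kappa> \<in> young L n" "parts_of L \<nu> = parts_of L \<kappa>"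
    then have eq: "diagram \<nu> = diagram \<kappa>"
      using cells_parts_of[of \<nu> L] cells_parts_of[of \<kappa> L] by (simp add: young_def)
    have mem: "(Suc i, b) \<in> diagram \<phi> \<longleftrightarrow> 1 \<le> b \<and> b \<le> \<phi> i" for i b \<phi> by (simp add: diagram_def)
    show "\<nu> = \<kappa>"
    proof
      fix i
      have "1 \<le> b \<and> b \<le> \<nu> i \<longleftrightarrow> 1 \<le> b \<and> b \<le> \<kappa> i" for b
        unfolding mem[symmetric] eq ..
      from this[of "\<nu> i"] this[of "\<kappa> i"] show "\<nu> i = \<kappa> i" by auto
    qed
  qed
  show "parts_of L ` young L n = partitions n"
  proof (intro equalityI subsetI)
    fix \<mu> assume "\<mu> \<in> parts_of L ` young L n"
    then show "\<mu> \<in> partitions n" by (auto simp: partitions_def young_def sum_mset_parts_of) (auto simp: parts_of_def)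
  next
    fix \<mu> assume \<mu>: "\<mu> \<in> partitions n"
    define \<nu> where "\<nu> i = (if i < length (rows \<mu>) then rows \<mu> ! i else 0)" for i
    have mset: "mset (rows \<mu>) = \<mu>" by (simp add: rows_def)
    \<comment> \<open>Parts are positive, so there are at most \<open>n\<close> of them and they fit
      into \<open>L\<close> rows.\<close>
    have "size M \<le> \<Sum>\<^sub># M" if "0 \<notin># M" for M :: "nat multiset"
      using that by (induction M) auto
    then have "length (rows \<mu>) \<le> L"
      using \<mu> assms mset by (metis (mono_tags, lifting) le_trans mem_Collect_eq partitions_def size_mset)
    then have "map \<nu> [0..<L] = rows \<mu> @ replicate (L - length (rows \<mu>)) 0"
      by (intro nth_equalityI) (auto simp: \<nu>_def nth_append)
    moreover have "filter (\<lambda>x. x \<noteq> 0) (rows \<mu>) = rows \<mu>"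
      using \<mu> by (auto simp: filter_id_conv partitions_def rows_def intro!: gr0I)
    ultimately have parts: "parts_of L \<nu> = \<mu>" using mset by (simp add: parts_of_eq_mset)
    have "sorted_wrt (\<ge>) (rows \<mu>)" by (simp add: rows_def sorted_wrt_rev)
    then have "antimono \<nu>"
      by (intro antimonoI) (auto simp: \<nu>_def sorted_wrt_iff_nth_less le_less)
    moreover have "\<forall>i\<ge>L. \<nu> i = 0" using \<open>length (rows \<mu>) \<le> L\<close> by (auto simp: \<nu>_def)
    ultimately have "\<nu> \<in> young L n"
      using \<mu> sum_mset_parts_of[of L \<nu>] by (simp add: young_def parts partitions_def)
    then show "\<mu> \<in> parts_of L ` young L n" using parts by blast
  qed
qed

section \<open>Removable corners and distinct parts\<close>

lemma parts_of_rem_box: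
  assumes "\<nu> \<in> young L n" "removable \<nu> i"
  shows "parts_of L (rem_box \<nu> i) = part_dec (\<nu> i) (parts_of L \<nu>)"
proof -
  have i: "i < L" "\<nu> i \<noteq> 0" using removable_less[OF assms] assms(2) by (auto simp: removable_def)
  have "{..<L} = insert i ({..<L} - {i})" using i by auto
  then have L: "mset_set {..<L} = add_mset i (mset_set ({..<L} - {i}))"
    by (metis Diff_iff finite_Diff finite_lessThan insertI1 mset_set.insert)
  have "image_mset (rem_box \<nu> i) (mset_set ({..<L} - {i})) = image_mset \<nu> (mset_set ({..<L} - {i}))"
    by (intro image_mset_cong) auto
  then show ?thesis using i by (auto simp: parts_of_def part_dec_def L)
qed

text \<open>A removable row is the last one of its length, so the parts of size at least
  \<open>\<nu> i\<close> are the rows \<open>0..i\<close>, which are \<open>i + 1\<close> in number.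
  The value is the content of the corner cell.\<close>

lemma part_content_parts_of:
  assumes "\<nu> \<in> young L n" "removable \<nu> i"
  shows "part_content (parts_of L \<nu>) (\<nu> i) = int (\<nu> i) - int (Suc i)"
proof -
  have anti: "antimono \<nu>" using assms(1) by (simp add: young_def)
  have i: "i < L" "\<nu> i \<noteq> 0" using removable_less[OF assms] assms(2) by (auto simp: removable_def)
  have "(\<Sum>k | k \<in># parts_of L \<nu> \<and> \<nu> i \<le> k. count (parts_of L \<nu>) k) = size (filter_mset (\<lambda>k. \<nu> i \<le> k) (parts_of L \<nu>))"
    by (simp add: size_multiset_overloaded_eq)
  also have "filter_mset (\<lambda>k. \<nu> i \<le> k) (parts_of L \<nu>) = image_mset \<nu> (mset_set {k \<in> {..<L}. \<nu> i \<le> \<nu> k \<and> \<nu> k \<noteq> 0})"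
    by (simp add: parts_of_def filter_mset_image_mset filter_filter_mset conj_ac)
  also have "{k \<in> {..<L}. \<nu> i \<le> \<nu> k \<and> \<nu> k \<noteq> 0} = {..i}"
  proof (intro equalityI subsetI)
    fix k assume k: "k \<in> {k \<in> {..<L}. \<nu> i \<le> \<nu> k \<and> \<nu> k \<noteq> 0}"
    show "k \<in> {..i}"
    proof (rule ccontr)
      assume "k \<notin> {..i}"
      then have "\<nu> k \<le> \<nu> (Suc i)" using antimonoD[OF anti, of "Suc i" k] by simp
      then show False using k assms(2) by (simp add: removable_def)
    qed
  next
    fix k assume "k \<in> {..i}"
    then show "k \<in> {k \<in> {..<L}. \<nu> i \<le> \<nu> k \<and> \<nu> k \<noteq> 0}" using i antimonoD[OF anti, of k i] by auto
  qed
  finally show ?thesis by (simp add: part_content_def)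
qed

text \<open>Each distinct part is matched with the last row of that length. This turns sums over
  corners into sums over distinct parts.\<close>

lemma bij_betw_removable:
  assumes "\<nu> \<in> young L n"
  shows "bij_betw \<nu> {i. removable \<nu> i} (set_mset (parts_of L \<nu>))"
  unfolding bij_betw_def
proof
  have anti: "antimono \<nu>" using assms by (simp add: young_def)
  have less: "\<nu> j < \<nu> i" if "i < j" "removable \<nu> i" for i j
    using antimonoD[OF anti, of "Suc i" j] that by (simp add: removable_def)
  show "inj_on \<nu> {i. removable \<nu> i}"
    by (rule inj_onI) (metis less less_irrefl linorder_neqE_nat mem_Collect_eq)
  show "\<nu> ` {i. removable \<nu> i} = set_mset (parts_of L \<nu>)"
  proof (intro equalityI subsetI)
    fix v assume "v \<in> \<nu> ` {i. removable \<nu> i}"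
    then show "v \<in># parts_of L \<nu>"
      using removable_less[OF assms] by (auto simp: parts_of_def removable_def)
  next
    fix v assume "v \<in># parts_of L \<nu>"
    then obtain k where k: "\<nu> k = v" "v \<noteq> 0" "k < L" by (auto simp: parts_of_def)
    define i where "i = Max {k. k < L \<and> \<nu> k = v}"
    have fin: "finite {k. k < L \<and> \<nu> k = v}" by simp
    have i: "i < L" "\<nu> i = v" using Max_in[OF fin] k unfolding i_def by blast+
    have "\<nu> (Suc i) \<noteq> v"
    proof
      assume eq: "\<nu> (Suc i) = v"
      then have "Suc i < L" using assms k(2) by (cases "Suc i < L") (auto simp: young_def)
      then have "Suc i \<le> i" using eq Max_ge[OF fin, of "Suc i"] unfolding i_def by simp
      then show False by simp
    qed
    then have "removable \<nu> i" using antimonoD[OF anti, of i "Suc i"] i by (simp add: removable_def)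
    then show "v \<in> \<nu> ` {i. removable \<nu> i}" using i by blast
  qed
qed

lemma diagram_add_box: "diagram (add_box \<nu> k) = insert (Suc k, Suc (\<nu> k)) (diagram \<nu>)"
  by (auto simp: diagram_def le_Suc_eq split: if_splits)

lemma diagram_zero: "diagram (\<lambda>_. 0) = {}"
  by (auto simp: diagram_def)

lemma diagram_eq_image: 
  assumes "\<forall>i\<ge>L. \<nu> i = 0"
  shows "diagram \<nu> = (\<lambda>(i, b). (Suc i, Suc b)) ` (SIGMA i:{..<L}. {..<\<nu> i})"
proof (intro equalityI subsetI)
  fix x assume "x \<in> diagram \<nu>"
  then obtain a b where x: "x = (a, b)" "1 \<le> a" "1 \<le> b" "b \<le> \<nu> (a - 1)" by (auto simp: diagram_def)
  then have "a - 1 < L" using assms by (metis One_nat_def le_zero_eq linorder_not_less not_one_le_zero)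
  then show "x \<in> (\<lambda>(i, b). (Suc i, Suc b)) ` (SIGMA i:{..<L}. {..<\<nu> i})"
    using x by (intro image_eqI[of _ _ "(a - 1, b - 1)"]) auto
qed (auto simp: diagram_def)

lemma finite_diagram: "\<nu> \<in> young L n \<Longrightarrow> finite (diagram \<nu>)"
  by (auto simp: young_def diagram_eq_image[of L \<nu>])

lemma card_diagram: 
  assumes "\<nu> \<in> young L n"
  shows "card (diagram \<nu>) = n"
proof -
  have "inj_on (\<lambda>(i, b). (Suc i, Suc b)) A" for A by (auto simp: inj_on_def)
  then show ?thesis using assms by (simp add: young_def diagram_eq_image[of L \<nu>] card_image)
qed

section \<open>Standard fillings and the branching rule for tableaux\<close>

definition std_fillings :: "nat \<Rightarrow> (nat \<times> nat) set \<Rightarrow> (nat \<times> nat \<Rightarrow> nat) set" where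
  "std_fillings n C = {T \<in> extensional C. bij_betw T C {1..n} \<and>
     (\<forall>a b. (a, b) \<in> C \<and> (a, b + 1) \<in> C \<longrightarrow> T (a, b) < T (a, b + 1)) \<and>
     (\<forall>a b. (a, b) \<in> C \<and> (a + 1, b) \<in> C \<longrightarrow> T (a, b) < T (a + 1, b))}"

lemma standard_tableaux_parts_of:
  "\<nu> \<in> young L n \<Longrightarrow> standard_tableaux (parts_of L \<nu>) = std_fillings n (diagram \<nu>)"
  by (simp add: young_def standard_tableaux_def std_fillings_def sum_mset_parts_of cells_parts_of)

lemma finite_std_fillings: "finite C \<Longrightarrow> finite (std_fillings n C)"
  by (rule finite_subset[OF _ finite_PiE[of C "\<lambda>_. {1..n}"]])
    (auto simp: std_fillings_def PiE_def bij_betw_def)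

text \<open>The new cell has no right or lower neighbour in \<open>D\<close>, so the largest entry
  can be deleted from it or put into it without violating the order conditions.\<close>

lemma bij_betw_std_fillings_corner:
  assumes x: "(a, b) \<notin> D" "(a, b + 1) \<notin> D" "(a + 1, b) \<notin> D"
  shows "bij_betw (\<lambda>T. restrict T D) {T \<in> std_fillings (Suc n) (insert (a, b) D). T (a, b) = Suc n} (std_fillings n D)"
proof (rule bij_betw_byWitness[where f' = "\<lambda>T. T((a, b) := Suc n)"])
  have ins: "{1..Suc n} = insert (Suc n) {1..n}" by auto
  have bij: "bij_betw T (insert (a, b) D) {1..Suc n} \<longleftrightarrow> bij_betw T D {1..n}" if "T (a, b) = Suc n" for T
    unfolding ins using notIn_Un_bij_betw3[OF x(1), of T "{1..n}"] that by simp
  show "\<forall>T\<in>{T \<in> std_fillings (Suc n) (insert (a, b) D). T (a, b) = Suc n}. (restrict T D)((a, b) := Suc n) = T"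
    by (auto simp: std_fillings_def extensional_def restrict_def fun_eq_iff)
  show "\<forall>T\<in>std_fillings n D. restrict (T((a, b) := Suc n)) D = T"
    using x(1) by (auto simp: std_fillings_def extensional_def restrict_def fun_eq_iff)
  show "(\<lambda>T. restrict T D) ` {T \<in> std_fillings (Suc n) (insert (a, b) D). T (a, b) = Suc n} \<subseteq> std_fillings n D"
  proof clarify
    fix T assume T: "T \<in> std_fillings (Suc n) (insert (a, b) D)" "T (a, b) = Suc n"
    then have "bij_betw T D {1..n}" using bij by (auto simp: std_fillings_def)
    then have "bij_betw (restrict T D) D {1..n}" by (simp cong: bij_betw_cong)
    then show "restrict T D \<in> std_fillings n D" using T by (auto simp: std_fillings_def)
  qed
  show "(\<lambda>T. T((a, b) := Suc n)) ` std_fillings n D \<subseteq> {T \<in> std_fillings (Suc n) (insert (a, b) D). T (a, b) = Suc n}"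
  proof clarify
    fix T assume T: "T \<in> std_fillings n D"
    let ?T = "T((a, b) := Suc n)"
    have "bij_betw ?T D {1..n} \<longleftrightarrow> bij_betw T D {1..n}" using x(1) by (intro bij_betw_cong) auto
    then have "bij_betw ?T (insert (a, b) D) {1..Suc n}" using bij[of ?T] T by (simp add: std_fillings_def)
    moreover have lt: "T y < Suc n" if "y \<in> D" for y
      using T that by (auto simp: std_fillings_def bij_betw_def less_Suc_eq_le)
    moreover have "?T \<in> extensional (insert (a, b) D)" using T by (auto simp: std_fillings_def extensional_def)
    ultimately show "?T \<in> std_fillings (Suc n) (insert (a, b) D) \<and> ?T (a, b) = Suc n"
      using T x by (simp add: std_fillings_def) (auto simp: lt)
  qed
qed

text \<open>The fillings are classified by the position of the largest entry \<open>n + 1\<close>,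
  which has no neighbour to the right or below and thus sits at the end of a removable row.\<close>

lemma card_std_fillings:
  assumes \<nu>: "\<nu> \<in> young L (Suc n)"
  shows "card (std_fillings (Suc n) (diagram \<nu>)) = (\<Sum>i | removable \<nu> i. card (std_fillings n (diagram (rem_box \<nu> i))))"
proof -
  define S where "S i = {T \<in> std_fillings (Suc n) (diagram \<nu>). T (Suc i, \<nu> i) = Suc n}" for i
  have pos: "(Suc i, \<nu> i) \<in> diagram \<nu>" if "removable \<nu> i" for i
    using that by (simp add: diagram_def removable_def)
  have "std_fillings (Suc n) (diagram \<nu>) = (\<Union>i\<in>{i. removable \<nu> i}. S i)"
  proof (intro equalityI subsetI)
    fix T assume T: "T \<in> std_fillings (Suc n) (diagram \<nu>)"
    then have im: "T ` diagram \<nu> = {1..Suc n}" by (simp add: std_fillings_def bij_betw_def)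
    then have "Suc n \<in> T ` diagram \<nu>" by simp
    then obtain a b where ab: "(a, b) \<in> diagram \<nu>" "T (a, b) = Suc n" by force
    have le: "T y \<le> Suc n" if "y \<in> diagram \<nu>" for y using im that by force
    have "(a, b + 1) \<notin> diagram \<nu>" "(a + 1, b) \<notin> diagram \<nu>"
      using T ab le[of "(a, b + 1)"] le[of "(a + 1, b)"] by (fastforce simp: std_fillings_def)+
    then have "b = \<nu> (a - 1)" "\<nu> a < b" "1 \<le> a" using ab(1) by (auto simp: diagram_def)
    then have "removable \<nu> (a - 1)" "T \<in> S (a - 1)" using ab T by (auto simp: removable_def S_def)
    then show "T \<in> (\<Union>i\<in>{i. removable \<nu> i}. S i)" by blast
  qed (auto simp: S_def)
  moreover have "S i \<inter> S j = {}" if "removable \<nu> i" "removable \<nu> j" "i \<noteq> j" for i j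
  proof (rule ccontr)
    assume "S i \<inter> S j \<noteq> {}"
    then obtain T where "T \<in> S i" "T \<in> S j" by blast
    then have "inj_on T (diagram \<nu>)" "T (Suc i, \<nu> i) = T (Suc j, \<nu> j)"
      by (simp_all add: S_def std_fillings_def bij_betw_def)
    then show False using pos[OF that(1)] pos[OF that(2)] that(3) by (auto dest: inj_onD)
  qed
  moreover have "finite (S i)" for i
    using finite_std_fillings[OF finite_diagram[OF \<nu>]] by (simp add: S_def)
  ultimately have "card (std_fillings (Suc n) (diagram \<nu>)) = (\<Sum>i | removable \<nu> i. card (S i))"
    using finite_removable[OF \<nu>] by (simp add: card_UN_disjoint)
  also have "\<dots> = (\<Sum>i | removable \<nu> i. card (std_fillings n (diagram (rem_box \<nu> i))))"
  proof (rule sum.cong)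
    fix i assume "i \<in> {i. removable \<nu> i}"
    then have i: "removable \<nu> i" by simp
    have pos_i: "\<nu> i > 0" using i by (simp add: removable_def)
    have eq: "diagram \<nu> = insert (Suc i, \<nu> i) (diagram (rem_box \<nu> i))"
      using diagram_add_box[of "rem_box \<nu> i" i] rem_box_young(3)[OF \<nu> i] pos_i by simp
    have "(Suc i, \<nu> i) \<notin> diagram (rem_box \<nu> i)" "(Suc i, \<nu> i + 1) \<notin> diagram (rem_box \<nu> i)"
      "(Suc i + 1, \<nu> i) \<notin> diagram (rem_box \<nu> i)"
      using pos_i i by (auto simp: diagram_def removable_def)
    then show "card (S i) = card (std_fillings n (diagram (rem_box \<nu> i)))"
      unfolding S_def eq by (rule bij_betw_same_card[OF bij_betw_std_fillings_corner])
  qed simp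
  finally show ?thesis .
qed

lemma branching_num_syt: "branching L (\<lambda>\<nu>. of_nat (num_syt (parts_of L \<nu>)))"
  unfolding branching_def
proof (intro conjI allI ballI)
  have "(\<lambda>_. 0) \<in> young L 0" by (simp add: young_0)
  \<comment> \<open>The empty diagram carries exactly one filling, the extensional function that is
    \<open>undefined\<close> everywhere.\<close>
  then have "standard_tableaux (parts_of L (\<lambda>_. 0)) = {\<lambda>_. undefined}"
    by (simp add: standard_tableaux_parts_of diagram_zero) (auto simp: std_fillings_def bij_betw_def)
  then show "rat_of_nat (num_syt (parts_of L (\<lambda>_. 0))) = 1" by (simp add: num_syt_def)
  fix n \<nu> assume \<nu>: "\<nu> \<in> young L (Suc n)"
  have "num_syt (parts_of L \<nu>) = (\<Sum>i | removable \<nu> i. num_syt (parts_of L (rem_box \<nu> i)))"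
    using rem_box_young(1)[OF \<nu>]
    by (simp add: num_syt_def standard_tableaux_parts_of[OF \<nu>] standard_tableaux_parts_of[of _ L n] card_std_fillings[OF \<nu>]
         del: fun_upd_apply)
  then show "rat_of_nat (num_syt (parts_of L \<nu>)) = (\<Sum>i | removable \<nu> i. of_nat (num_syt (parts_of L (rem_box \<nu> i))))"
    by simp
qed

section \<open>Contents and the content polynomial\<close>

lemma contents_parts_of:
  "\<nu> \<in> young L n \<Longrightarrow> contents (parts_of L \<nu>) = image_mset (\<lambda>(a, b). int b - int a) (mset_set (diagram \<nu>))"
  by (simp add: contents_def cells_parts_of young_def)

lemma content_prod_eq_poly:
  "T \<in> paths n \<Longrightarrow> n \<le> L \<Longrightarrow> content_prod t T = poly (content_poly (parts_of L (shape T))) t"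
proof (induction n arbitrary: T)
  case 0
  have "(\<lambda>_. 0) \<in> young L 0" by (simp add: young_0)
  then show ?case using 0 by (simp add: paths_0 content_poly_def contents_parts_of diagram_zero)
next
  case (Suc n)
  then obtain i U where T: "T = i # U" and U: "U \<in> paths n"
    by (auto simp: paths_def length_Suc_conv)
  have y: "shape U \<in> young L n" "shape T \<in> young L (Suc n)"
    using shape_in_young[OF U] shape_in_young[OF Suc.prems] Suc.prems(2) by auto
  have "(Suc i, Suc (shape U i)) \<notin> diagram (shape U)" by (simp add: diagram_def)
  moreover have "diagram (shape T) = insert (Suc i, Suc (shape U i)) (diagram (shape U))"
    unfolding T shape.simps by (rule diagram_add_box)
  ultimately have "contents (parts_of L (shape T)) = add_mset (int (shape U i) - int i) (contents (parts_of L (shape U)))"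
    using finite_diagram[OF y(1)] by (simp add: contents_parts_of[OF y(1)] contents_parts_of[OF y(2)])
  then have "poly (content_poly (parts_of L (shape T))) t
      = (t + row_content (shape U) i) * poly (content_poly (parts_of L (shape U))) t"
    by (simp add: content_poly_def row_content_def algebra_simps)
  moreover have "content_prod t T = content_prod t U * (t + row_content (shape U) i)" by (simp add: T)
  ultimately show ?case using Suc.IH[OF U] Suc.prems(2) by (simp only: mult.commute Suc_leD)
qed

text \<open>This is Vieta's formula: in the expanded product, the subset \<open>X\<close> collects
  the factors that contribute their constant term.\<close>

lemma coeff_prod_mset_linear:
  "coeff (\<Prod>c\<in>#M. [:of_int c, 1:] :: rat poly) k = of_int (elem_sym (int (size M) - int k) M)"
proof -
  define xs where "xs = sorted_list_of_multiset M"
  let ?A = "{..<length xs}"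
  have M: "M = mset xs" by (simp add: xs_def)
  have "(\<Prod>c\<in>#M. [:of_int c, 1:] :: rat poly) = (\<Prod>i\<in>?A. [:of_int (xs ! i):] + monom 1 1)"
  proof -
    have "(\<Prod>c\<in>#M. [:of_int c, 1:] :: rat poly) = prod_list (map (\<lambda>c. [:of_int c, 1:]) xs)"
      by (simp only: M mset_map[symmetric] prod_mset_prod_list)
    also have "\<dots> = (\<Prod>i\<in>?A. [:of_int (xs ! i), 1:])"
      by (simp add: prod.list_conv_set_nth atLeast0LessThan)
    finally show ?thesis by (simp add: monom_Suc one_pCons)
  qed
  also have "\<dots> = (\<Sum>X\<in>Pow ?A. (\<Prod>i\<in>X. [:of_int (xs ! i):]) * (\<Prod>i\<in>?A - X. monom 1 1))"
    by (rule prod_add) simp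
  also have "\<dots> = (\<Sum>X\<in>Pow ?A. monom (of_int (\<Prod>i\<in>X. xs ! i)) (length xs - card X))"
  proof (rule sum.cong)
    fix X assume "X \<in> Pow ?A"
    then have X: "X \<subseteq> ?A" "finite X" by (auto intro: finite_subset)
    have "(\<Prod>i\<in>X. [:of_int (xs ! i):]) = [:rat_of_int (\<Prod>i\<in>X. xs ! i):]"
      using X(2) by (induction X) auto
    moreover have "(\<Prod>i\<in>?A - X. monom 1 1 :: rat poly) = monom 1 (length xs - card X)"
      using X by (simp add: monom_power card_Diff_subset)
    ultimately show "(\<Prod>i\<in>X. [:of_int (xs ! i):]) * (\<Prod>i\<in>?A - X. monom 1 1)
        = monom (rat_of_int (\<Prod>i\<in>X. xs ! i)) (length xs - card X)"
      by (simp add: smult_monom del: of_int_prod)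
  qed simp
  finally have "coeff (\<Prod>c\<in>#M. [:of_int c, 1:] :: rat poly) k
      = (\<Sum>X\<in>Pow ?A. if length xs - card X = k then of_int (\<Prod>i\<in>X. xs ! i) else 0)"
    by (simp add: coeff_sum del: of_int_prod)
  also have "\<dots> = (\<Sum>X\<in>{X \<in> Pow ?A. length xs - card X = k}. of_int (\<Prod>i\<in>X. xs ! i))"
    by (subst sum.inter_filter) simp_all
  \<comment> \<open>The bound \<open>card X \<le> length xs\<close> reconciles truncated subtraction
    with the integer equation; for \<open>k > size M\<close> both sets are empty.\<close>
  also have "{X \<in> Pow ?A. length xs - card X = k} = {X. X \<subseteq> ?A \<and> int (card X) = int (size M) - int k}"
  proof -
    have "card X \<le> length xs" if "X \<subseteq> ?A" for X using card_mono[OF _ that] by simp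
    then show ?thesis by (force simp: M)
  qed
  finally show ?thesis by (simp add: elem_sym_def xs_def[symmetric] Let_def)
qed

lemma coeff_content_poly:
  assumes "\<mu> \<in> partitions n"
  shows "coeff (content_poly \<mu>) k = of_int (elem_sym (int n - int k) (contents \<mu>))"
proof -
  obtain \<nu> where \<nu>: "\<mu> = parts_of n \<nu>" "\<nu> \<in> young n n"
    using bij_betw_parts_of[of n n] assms by (auto simp: bij_betw_def)
  have "size (contents \<mu>) = n" by (simp add: \<nu> contents_parts_of[OF \<nu>(2)] card_diagram[OF \<nu>(2)])
  then show ?thesis unfolding content_poly_def coeff_prod_mset_linear by simp
qed

section \<open>From path sums to sums over partitions\<close>

lemma finite_young: "finite (young L n)"
proof (rule finite_subset)
  show "young L n \<subseteq> {f. \<forall>x. (x \<in> {..<L} \<longrightarrow> f x \<in> {..n}) \<and> (x \<notin> {..<L} \<longrightarrow> f x = 0)}"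
  proof
    fix \<nu> assume \<nu>: "\<nu> \<in> young L n"
    have "\<nu> x \<le> n" if "x < L" for x
      using \<nu> member_le_sum[of x "{..<L}" \<nu>] that by (simp add: young_def)
    then show "\<nu> \<in> {f. \<forall>x. (x \<in> {..<L} \<longrightarrow> f x \<in> {..n}) \<and> (x \<notin> {..<L} \<longrightarrow> f x = 0)}"
      using \<nu> by (auto simp: young_def)
  qed
qed (rule finite_set_of_finite_funs; simp)

text \<open>The weight and the content product of a path depend only on its shape. The last step is
  a removable row and fixes \<open>last_content\<close>; the paths before it are counted by the
  tableaux of the smaller shape.\<close>

lemma sum_path_set_eq:
  assumes \<nu>: "\<nu> \<in> young L n" and n: "n \<ge> 1" "n < L"
  defines "\<mu> \<equiv> parts_of L \<nu>"
  shows "(\<Sum>T\<in>path_set \<nu>. path_weight L T * (last_content T ^ r * content_prod t T))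
    = (\<Sum>j\<in>set_mset \<mu>. of_nat (num_syt \<mu>) * of_nat (num_syt (part_dec j \<mu>)) * of_int (part_content \<mu> j) ^ r
            / fact n * poly (content_poly \<mu>) t)"
proof -
  obtain m where m: "n = Suc m" using n(1) by (cases n) auto
  define K where "K = of_nat (num_syt \<mu>) / fact n * poly (content_poly \<mu>) t"
  have "path_weight L T * (last_content T ^ r * content_prod t T) = K * last_content T ^ r"
    if "T \<in> path_set \<nu>" for T
  proof -
    have T: "T \<in> paths n" "shape T = \<nu>" using path_set_subset_paths[OF \<nu>] that by (auto simp: path_set_def)
    then show ?thesis using n
      by (simp add: K_def \<mu>_def path_weight_eq[OF branching_num_syt T(1)] content_prod_eq_poly[OF T(1), where L = L])
  qed
  then have "(\<Sum>T\<in>path_set \<nu>. path_weight L T * (last_content T ^ r * content_prod t T))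
      = (\<Sum>T\<in>path_set \<nu>. K * last_content T ^ r)" by (intro sum.cong refl)
  also have "\<dots> = (\<Sum>i | removable \<nu> i. \<Sum>T\<in>path_set (rem_box \<nu> i). K * last_content (i # T) ^ r)"
    by (rule sum_path_set_Suc[OF \<nu>[unfolded m]])
  also have "\<dots> = (\<Sum>i | removable \<nu> i. of_nat (num_syt \<mu>) * of_nat (num_syt (part_dec (\<nu> i) \<mu>)) * of_int (part_content \<mu> (\<nu> i)) ^ r
            / fact n * poly (content_poly \<mu>) t)"
  proof (rule sum.cong)
    fix i assume "i \<in> {i. removable \<nu> i}"
    then have i: "removable \<nu> i" by simp
    then have "\<nu> i > 0" by (simp add: removable_def)
    then have "last_content (i # T) = of_int (part_content \<mu> (\<nu> i))" if "T \<in> path_set (rem_box \<nu> i)" for T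
      using that by (simp add: \<mu>_def part_content_parts_of[OF \<nu> i] path_set_def row_content_def of_nat_diff)
    then have "(\<Sum>T\<in>path_set (rem_box \<nu> i). K * last_content (i # T) ^ r)
        = of_nat (card (path_set (rem_box \<nu> i))) * (K * of_int (part_content \<mu> (\<nu> i)) ^ r)" by simp
    also have "rat_of_nat (card (path_set (rem_box \<nu> i))) = of_nat (num_syt (part_dec (\<nu> i) \<mu>))"
      unfolding \<mu>_def parts_of_rem_box[OF \<nu> i, symmetric]
      by (rule branching_unique[OF branching_card_path_set branching_num_syt rem_box_young(1)[OF \<nu>[unfolded m] i]])
    also have "\<dots> * (K * of_int (part_content \<mu> (\<nu> i)) ^ r)
        = of_nat (num_syt \<mu>) * of_nat (num_syt (part_dec (\<nu> i) \<mu>)) * of_int (part_content \<mu> (\<nu> i)) ^ r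
            / fact n * poly (content_poly \<mu>) t" by (simp add: K_def)
    finally show "(\<Sum>T\<in>path_set (rem_box \<nu> i). K * last_content (i # T) ^ r)
        = of_nat (num_syt \<mu>) * of_nat (num_syt (part_dec (\<nu> i) \<mu>)) * of_int (part_content \<mu> (\<nu> i)) ^ r
            / fact n * poly (content_poly \<mu>) t" .
  qed simp
  also have "\<dots> = (\<Sum>j\<in>set_mset \<mu>. of_nat (num_syt \<mu>) * of_nat (num_syt (part_dec j \<mu>)) * of_int (part_content \<mu> j) ^ r
            / fact n * poly (content_poly \<mu>) t)"
    unfolding \<mu>_def by (rule sum.reindex_bij_betw[OF bij_betw_removable[OF \<nu>]])
  finally show ?thesis .
qed

theorem star_factorizations_eq_poly:
  assumes "n \<ge> 1"
  shows "(\<Sum>\<tau>s | length \<tau>s = r \<and> set \<tau>s \<subseteq> star_transpositions n. monom 1 (num_cycles n (perm_product \<tau>s)))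
    = (\<Sum>\<mu>\<in>partitions n. \<Sum>j\<in>set_mset \<mu>.
          smult (of_nat (num_syt \<mu>) * of_nat (num_syt (part_dec j \<mu>)) * of_int (part_content \<mu> j) ^ r
            / fact n) (content_poly \<mu>))" (is "?l = ?r")
proof -
  \<comment> \<open>One row is added beyond the at most \<open>n\<close> non-empty ones, as the
    transition weights require.\<close>
  define L where "L = Suc n"
  have L: "n < L" "n \<le> L" by (auto simp: L_def)
  \<comment> \<open>The path sum formula holds for each rational \<open>t\<close>, and a polynomial
    over an infinite field is determined by its values.\<close>
  have "poly ?l t = poly ?r t" for t
  proof -
    define g where "g \<mu> = (\<Sum>j\<in>set_mset \<mu>. of_nat (num_syt \<mu>) * of_nat (num_syt (part_dec j \<mu>)) * of_int (part_content \<mu> j) ^ r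
            / fact n * poly (content_poly \<mu>) t)" for \<mu>
    define h where "h T = path_weight L T * (last_content T ^ r * content_prod t T)" for T
    have "poly ?l t = (\<Sum>T\<in>paths n. h T)"
      unfolding h_def star_factorizations_path_sum[OF assms L(1), symmetric] by (simp add: poly_sum poly_monom)
    also have "\<dots> = (\<Sum>\<nu>\<in>young L n. \<Sum>T\<in>{T \<in> paths n. shape T = \<nu>}. h T)"
      using shape_in_young[OF _ L(2)] by (intro sum.group[symmetric] finite_paths finite_young) auto
    also have "\<dots> = (\<Sum>\<nu>\<in>young L n. \<Sum>T\<in>path_set \<nu>. h T)"
    proof (rule sum.cong)
      fix \<nu> assume "\<nu> \<in> young L n"
      then have "{T \<in> paths n. shape T = \<nu>} = path_set \<nu>"
        using path_set_subset_paths[of \<nu> L n] by (auto simp: path_set_def paths_def)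
      then show "(\<Sum>T\<in>{T \<in> paths n. shape T = \<nu>}. h T) = (\<Sum>T\<in>path_set \<nu>. h T)" by simp
    qed simp
    also have "\<dots> = (\<Sum>\<nu>\<in>young L n. g (parts_of L \<nu>))"
      unfolding h_def g_def by (rule sum.cong[OF refl]) (rule sum_path_set_eq[OF _ assms L(1)])
    also have "\<dots> = (\<Sum>\<mu>\<in>partitions n. g \<mu>)"
      by (rule sum.reindex_bij_betw[OF bij_betw_parts_of[OF L(2)]])
    also have "\<dots> = poly ?r t"
      by (simp add: poly_sum g_def)
    finally show ?thesis .
  qed
  then show ?thesis by (simp add: poly_eq_poly_eq_iff[symmetric] fun_eq_iff)
qed

theorem theorem4p4:
  fixes n r k :: nat
  assumes "r \<ge> 1" and "k \<ge> 1"
  shows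
    "of_nat (card {\<tau>s. length \<tau>s = r \<and> set \<tau>s \<subseteq> star_transpositions n \<and>
                       num_cycles n (perm_product \<tau>s) = k})
     = (\<Sum>\<mu>\<in>partitions n. \<Sum>j\<in>set_mset \<mu>.
          of_nat (num_syt \<mu>) * of_nat (num_syt (part_dec j \<mu>)) * of_int (part_content \<mu> j) ^ r
            / fact n * (of_int (elem_sym (int n - int k) (contents \<mu>)) :: rat))
     \<and>
     (\<Sum>\<mu>\<in>partitions n. \<Sum>j\<in>set_mset \<mu>.
          of_nat (num_syt \<mu>) * of_nat (num_syt (part_dec j \<mu>)) * of_int (part_content \<mu> j) ^ r
            / fact n * (of_int (elem_sym (int n - int k) (contents \<mu>)) :: rat))
     = coeff (\<Sum>\<mu>\<in>partitions n. \<Sum>j\<in>set_mset \<mu>.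
          smult (of_nat (num_syt \<mu>) * of_nat (num_syt (part_dec j \<mu>)) * of_int (part_content \<mu> j) ^ r
            / fact n) (content_poly \<mu>)) k"
    (is "?count = ?sum \<and> ?sum = coeff ?poly k")
proof -
  have vieta: "?sum = coeff ?poly k"
    by (simp add: coeff_sum coeff_content_poly)
  have "?count = coeff ?poly k"
  proof (cases "n = 0")
    \<comment> \<open>Both sides vanish: as \<open>r \<ge> 1\<close> there are no sequences, and the
      empty partition has no parts to sum over.\<close>
    case True
    have "\<mu> = {#}" if "\<mu> \<in> partitions 0" for \<mu>
      using that by (cases \<mu>) (auto simp: partitions_def)
    then have part: "partitions 0 = {{#}}" by (auto simp: partitions_def)
    have none: "{\<tau>s. length \<tau>s = r \<and> set \<tau>s \<subseteq> star_transpositions 0 \<and> num_cycles 0 (perm_product \<tau>s) = k} = {}"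
      using assms(1) by (auto simp: star_transpositions_def)
    show ?thesis unfolding True none part by simp
  next
    case False
    let ?S = "{\<tau>s. length \<tau>s = r \<and> set \<tau>s \<subseteq> star_transpositions n}"
    have "star_transpositions n = (\<lambda>j. transpose j n) ` {1..n - 1}"
      by (auto simp: star_transpositions_def)
    then have fin: "finite ?S" using finite_lists_length_eq[of "star_transpositions n" r] by (simp add: conj_commute)
    have "coeff ?poly k = (\<Sum>\<tau>s\<in>?S. if num_cycles n (perm_product \<tau>s) = k then 1 else 0)"
      using False by (simp add: star_factorizations_eq_poly[symmetric] coeff_sum)
    also have "\<dots> = of_nat (card {\<tau>s \<in> ?S. num_cycles n (perm_product \<tau>s) = k})"
      using fin by (simp add: sum.inter_filter[symmetric])
    finally show ?thesis by (simp add: conj_assoc)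
  qed
  then show ?thesis using vieta by simp
qed

end
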